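(* Let $k$ be a field and let $\Gamma$ be a finite (nonempty) quiver in which every vertex has degree at least $2$. Then the preprojective algebra $\Pi(\Gamma)$ over $k$ is a piecewise domain. If moreover $\Gamma$ is connected, then $\Pi(\Gamma)$ is a prime piecewise domain.
   Context: The degree of a vertex $v$ in a quiver $\Gamma$ is its degree in the underlying graph of $\Gamma$, equal to the sum of the indegree of $v$ (number of arrows with target $v$) and the outdegree of $v$ (number of arrows with source $v$). A quiver is connected if its underlying graph is connected. The double quiver $\overline\Gamma$ is obtained from $\Gamma$ by adding, for every arrow $\alpha:i\to j$, a new arrow $\alpha^*:j\to i$. The preprojective algebra is $\Pi(\Gamma)=k\overline\Gamma/I$, where $I$ is the ideal generated by $\sum_{\alpha}(\alpha\alpha^*-\alpha^*\alpha)$, the sum over all arrows $\alpha$ of $\Gamma$. Piecewise domain: let $R$ be a ring with pairwise orthogonal idempotents $\{e_i\}$ such that $1=\sum_{i=1}^r e_i$. $R$ is a piecewise domain (with respect to $\{e_i\}$) if for all $i,j,\ell$: $x\in e_iRe_j$, $y\in e_jRe_\ell$ and $xy=0$ imply $x=0$ or $y=0$. For $\Pi(\Gamma)$ the idempotents are the images of the trivial paths at the vertices. *)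

theory Defs
  imports
    "Graph_Theory.Graph_Theory"
    "HOL-Algebra.QuotRing"
    "HOL-Algebra.Ideal_Product"
    "HOL-Library.Poly_Mapping"
begin

text \<open>
  A quiver is a \<^typ>\<open>('v, 'a) pre_digraph\<close> satisfying \<^locale>\<open>wf_digraph\<close>: loops and parallel
  arrows are allowed, an arrow goes from its \<^const>\<open>tail\<close> (source) to its \<^const>\<open>head\<close> (target).
  A loop contributes 2 to the degree of its vertex.
\<close>

definition quiver_degree :: "('v, 'a) pre_digraph \<Rightarrow> 'v \<Rightarrow> nat" where
  "quiver_degree \<Gamma> v = in_degree \<Gamma> v + out_degree \<Gamma> v"


section \<open>Path algebras\<close>

text \<open>
  A path is a triple: starting vertex, list of arrows, end vertex. The vertices are recorded so
  that the trivial paths \<open>(v, [], v)\<close> at different vertices differ. Paths are composed from left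
  to right, as in \<open>\<alpha>\<beta>\<close> = first \<open>\<alpha>\<close>, then \<open>\<beta>\<close>.
\<close>

type_synonym ('v, 'a) qpath = "'v \<times> 'a list \<times> 'v"

definition qpaths :: "('v, 'a) pre_digraph \<Rightarrow> ('v, 'a) qpath set" where
  "qpaths Q = {(u, p, v). pre_digraph.awalk Q u p v}"

text \<open>The scalar \<open>c\<close> times the product of two paths; zero if they are not composable.\<close>

fun path_prod :: "('v, 'a) qpath \<Rightarrow> ('v, 'a) qpath \<Rightarrow> 'k \<Rightarrow> (('v, 'a) qpath \<Rightarrow>\<^sub>0 'k::zero)" where
  "path_prod (u, p, v) (w, q, x) c = (if v = w then Poly_Mapping.single (u, p @ q, x) c else 0)"

definition trivial_path :: "'v \<Rightarrow> (('v, 'a) qpath \<Rightarrow>\<^sub>0 'k::field)" where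
  "trivial_path v = Poly_Mapping.single (v, [], v) 1"

definition arrow :: "('v, 'a) pre_digraph \<Rightarrow> 'a \<Rightarrow> (('v, 'a) qpath \<Rightarrow>\<^sub>0 'k::field)" where
  "arrow Q a = Poly_Mapping.single (tail Q a, [a], head Q a) 1"

text \<open>
  The path algebra over the field \<open>'k\<close>, as a ring: finitely supported \<open>'k\<close>-valued functions on
  the set of paths, with the product of paths extended bilinearly. (The product that
  \<^theory>\<open>HOL-Library.Poly_Mapping\<close> itself provides plays no role.)
\<close>

definition path_algebra ::
  "'k::field itself \<Rightarrow> ('v, 'a) pre_digraph \<Rightarrow> (('v, 'a) qpath \<Rightarrow>\<^sub>0 'k) ring" where
  "path_algebra K Q =
    \<lparr>carrier = {f. Poly_Mapping.keys f \<subseteq> qpaths Q},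
     mult = (\<lambda>f g. \<Sum>p\<in>Poly_Mapping.keys f. \<Sum>q\<in>Poly_Mapping.keys g.
              path_prod p q (Poly_Mapping.lookup f p * Poly_Mapping.lookup g q)),
     one = (\<Sum>v\<in>verts Q. trivial_path v),
     zero = 0,
     add = (+)\<rparr>"


section \<open>Preprojective algebras\<close>

text \<open>In the double quiver, \<open>Inl \<alpha>\<close> is the original arrow \<open>\<alpha>\<close> and \<open>Inr \<alpha>\<close> is \<open>\<alpha>\<^sup>*\<close>.\<close>

definition double_quiver :: "('v, 'a) pre_digraph \<Rightarrow> ('v, 'a + 'a) pre_digraph" where
  "double_quiver \<Gamma> =
    \<lparr>verts = verts \<Gamma>,
     arcs = Inl ` arcs \<Gamma> \<union> Inr ` arcs \<Gamma>,
     tail = case_sum (tail \<Gamma>) (head \<Gamma>),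
     head = case_sum (head \<Gamma>) (tail \<Gamma>)\<rparr>"

definition preprojective_relation ::
  "'k::field itself \<Rightarrow> ('v, 'a) pre_digraph \<Rightarrow> (('v, 'a + 'a) qpath \<Rightarrow>\<^sub>0 'k)" where
  "preprojective_relation K \<Gamma> =
    (let Q = double_quiver \<Gamma>; A = path_algebra K Q in
      \<Sum>\<alpha>\<in>arcs \<Gamma>. (arrow Q (Inl \<alpha>) \<otimes>\<^bsub>A\<^esub> arrow Q (Inr \<alpha>)) -
                 (arrow Q (Inr \<alpha>) \<otimes>\<^bsub>A\<^esub> arrow Q (Inl \<alpha>)))"

definition preprojective_ideal ::
  "'k::field itself \<Rightarrow> ('v, 'a) pre_digraph \<Rightarrow> (('v, 'a + 'a) qpath \<Rightarrow>\<^sub>0 'k) set" where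
  "preprojective_ideal K \<Gamma> =
    Idl\<^bsub>path_algebra K (double_quiver \<Gamma>)\<^esub> {preprojective_relation K \<Gamma>}"

definition preprojective_algebra ::
  "'k::field itself \<Rightarrow> ('v, 'a) pre_digraph \<Rightarrow> (('v, 'a + 'a) qpath \<Rightarrow>\<^sub>0 'k) set ring" where
  "preprojective_algebra K \<Gamma> =
    path_algebra K (double_quiver \<Gamma>) Quot preprojective_ideal K \<Gamma>"

definition vertex_idem ::
  "'k::field itself \<Rightarrow> ('v, 'a) pre_digraph \<Rightarrow> 'v \<Rightarrow> (('v, 'a + 'a) qpath \<Rightarrow>\<^sub>0 'k) set" where
  "vertex_idem K \<Gamma> v =
    preprojective_ideal K \<Gamma> +>\<^bsub>path_algebra K (double_quiver \<Gamma>)\<^esub> trivial_path v"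


section \<open>Piecewise domains and prime rings\<close>

text \<open>Rings are associative with one, not necessarily commutative.\<close>

definition peirce :: "('r, 'm) ring_scheme \<Rightarrow> 'r \<Rightarrow> 'r \<Rightarrow> 'r set" where
  "peirce R e f = {e \<otimes>\<^bsub>R\<^esub> r \<otimes>\<^bsub>R\<^esub> f | r. r \<in> carrier R}"

locale piecewise_domain = ring R for R (structure) +
  fixes I :: "'i set" and e :: "'i \<Rightarrow> 'a"
  assumes finite_index: "finite I"
    and idem_closed: "i \<in> I \<Longrightarrow> e i \<in> carrier R"
    and idem: "i \<in> I \<Longrightarrow> e i \<otimes> e i = e i"
    and orthogonal: "\<lbrakk>i \<in> I; j \<in> I; i \<noteq> j\<rbrakk> \<Longrightarrow> e i \<otimes> e j = \<zero>"
    and one_eq_sum: "\<one> = (\<Oplus>i\<in>I. e i)"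
    and no_zero_divisors:
      "\<lbrakk>i \<in> I; j \<in> I; l \<in> I; x \<in> peirce R (e i) (e j); y \<in> peirce R (e j) (e l); x \<otimes> y = \<zero>\<rbrakk>
        \<Longrightarrow> x = \<zero> \<or> y = \<zero>"

text \<open>
  The locale \<^locale>\<open>primeideal\<close> of \<open>HOL-Algebra\<close> is restricted to commutative rings; a
  noncommutative ring is prime if it is nonzero and its zero ideal is prime with respect to
  products of two-sided ideals.
\<close>

locale prime_ring = ring R for R (structure) +
  assumes one_not_zero: "\<one> \<noteq> \<zero>"
    and zero_ideal_prime:
      "\<lbrakk>ideal A R; ideal B R; A \<cdot> B = {\<zero>}\<rbrakk> \<Longrightarrow> A = {\<zero>} \<or> B = {\<zero>}"

end

theory Submission
  imports Defs "HOL-Library.List_Lenlexorder" "HOL-Library.Product_Lexorder"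
begin

text \<open>
  Write \<open>e\<^sup>*\<close> for the reverse of an arrow \<open>e\<close> of the double quiver. The relation cuts out, at every
  vertex \<open>v\<close>, the equation \<open>\<Sum> \<plusminus> e e\<^sup>* = 0\<close> over the arrows \<open>e\<close> that leave \<open>v\<close>. The proof is a
  leading-term argument: it finds a basis of the algebra consisting of paths, and an order on it for
  which the leading term of a product is the product of the leading terms.

  \<^emph>\<open>The basis.\<close> Since at least two arrows leave each vertex, walks without backtracking can be
  continued until they close up, and this makes it possible to choose an arrow \<open>c v\<close> out of every
  vertex \<open>v\<close> such that no \<open>c w\<close> is the reverse of a \<open>c v\<close> (\<open>ex_orients\<close>). Use the equation at \<open>v\<close> to
  rewrite \<open>c v (c v)\<^sup>*\<close> into the other \<open>e e\<^sup>*\<close>. As \<open>(c v)\<^sup>*\<close> is not chosen, no two left-hand sides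
  overlap, so the paths without a factor \<open>c v (c v)\<^sup>*\<close>, the normal ones, represent a basis. Concretely,
  left multiplication by an arrow is defined on combinations of paths by rewriting (\<open>act\<close>), the
  equations hold for these operators (\<open>act_relation\<close>), and therefore letting a path act on a trivial
  path gives a normal form that vanishes exactly on the ideal (\<open>ideal_iff_normal_form\<close>).

  \<^emph>\<open>The order.\<close> A product of normal paths need not be normal, so an order is needed that survives
  the rewriting. It comes from making all \<open>c v\<close> invertible and equal to one element \<open>t\<close>, without regard
  to the vertices. An arrow \<open>f\<close> such that neither \<open>f\<close> nor \<open>f\<^sup>*\<close> is chosen is called free; passed at
  \<open>t\<close>-degree \<open>h\<close>, it becomes a letter \<open>f\<^sub>h = t\<^sup>h f t\<^sup>-\<^sup>h\<close> of a free monoid on which \<open>t\<close> acts by shifting the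
  indices. There remain the arrows \<open>(c v)\<^sup>*\<close>. By the equation at \<open>v\<close>, \<open>t (c v)\<^sup>*\<close> is up to signs the sum of the
  \<open>e e\<^sup>*\<close> with \<open>e\<close> free and of the \<open>(c w)\<^sup>* t\<close> with \<open>c w\<close> ending in \<open>v\<close>. Unwinding the latter leads back
  along chosen arrows, and unless \<open>v\<close> lies on a cycle of chosen arrows it expresses \<open>(c v)\<^sup>*\<close> through
  the pairs \<open>f f\<^sup>*\<close> of free arrows \<open>f\<close> that start upstream of \<open>v\<close>; the leading one, that of the largest
  \<open>f\<close>, is taken as the value of \<open>(c v)\<^sup>*\<close>. On a cycle of chosen arrows a new letter fixed by \<open>t\<close> is used
  instead; written three times, it outweighs the pairs. The value \<open>val p\<close> of a path consists of its
  \<open>t\<close>-degree and its word, and values are compared first by degree, then by length, then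
  lexicographically.

  Three properties carry the argument. Concatenation is strictly monotone (\<open>val_mono_strict\<close>). Among
  the terms \<open>e e\<^sup>*\<close> with \<open>e \<noteq> c v\<close> none exceeds \<open>c v (c v)\<^sup>*\<close> and one attains its value
  (\<open>val_relation_le\<close>, \<open>val_relation_attained\<close>). And normal paths with the same ends are determined
  by their values (\<open>val_inj\<close>). Together they show that the normal form of a path \<open>p\<close> has a term
  of value \<open>val p\<close> and none above it (\<open>leads_path\<close>), and that the product of the leading terms of two
  nonzero normal forms survives in their product (\<open>normal_form_mult_nonzero\<close>). Hence there are no zero
  divisors between corners. If the quiver is connected, nonzero elements of two ideals have nonzero
  corners, and these can be joined by a path, which is nonzero in the algebra; so the product of the
  ideals is nonzero.
\<close>

section \<open>Linear maps on finitely supported functions\<close>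

definition pm_scale :: "'k::field \<Rightarrow> ('b \<Rightarrow>\<^sub>0 'k) \<Rightarrow> ('b \<Rightarrow>\<^sub>0 'k)" where
  "pm_scale c f = Poly_Mapping.map ((*) c) f"

lemma lookup_pm_scale [simp]:
  "Poly_Mapping.lookup (pm_scale c f) x = c * Poly_Mapping.lookup f x"
  by (simp add: pm_scale_def map.rep_eq when_def)

lemma pm_scale_single [simp]:
  "pm_scale c (Poly_Mapping.single x d) = Poly_Mapping.single x (c * d)"
  by (rule poly_mapping_eqI) (simp add: lookup_single when_def)

lemma pm_vector_space: "vector_space (pm_scale :: 'k::field \<Rightarrow> _)"
  by unfold_locales (auto intro!: poly_mapping_eqI simp: lookup_add algebra_simps)

interpretation pm: vector_space "pm_scale :: 'k::field \<Rightarrow> ('b \<Rightarrow>\<^sub>0 'k) \<Rightarrow> _"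
  by (rule pm_vector_space)

abbreviation pm_linear :: "(('b \<Rightarrow>\<^sub>0 'k::field) \<Rightarrow> ('c \<Rightarrow>\<^sub>0 'k)) \<Rightarrow> bool" where
  "pm_linear \<equiv> Vector_Spaces.linear pm_scale pm_scale"

lemma pm_linearI:
  assumes "\<And>f g. h (f + g) = h f + h g" "\<And>c f. h (pm_scale c f) = pm_scale c (h f)"
  shows "pm_linear h"
  by (simp add: Vector_Spaces.linear_iff pm_vector_space assms)

lemma pm_linear_add: "pm_linear h \<Longrightarrow> h (f + g) = h f + h g"
  and pm_linear_scale: "pm_linear h \<Longrightarrow> h (pm_scale c f) = pm_scale c (h f)"
  by (simp_all add: Vector_Spaces.linear_iff)

lemma pm_linear_zero: "pm_linear h \<Longrightarrow> h 0 = 0"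
  by (rule Modules.module_hom.zero) (simp add: Vector_Spaces.linear_iff_module_hom)

lemma pm_linear_sum: "pm_linear h \<Longrightarrow> h (\<Sum>i\<in>A. f i) = (\<Sum>i\<in>A. h (f i))"
  by (rule Modules.module_hom.sum) (simp add: Vector_Spaces.linear_iff_module_hom)

lemma pm_linear_minus: "pm_linear h \<Longrightarrow> h (- f) = - h f"
  by (rule Modules.module_hom.neg) (simp add: Vector_Spaces.linear_iff_module_hom)

lemma pm_linear_diff: "pm_linear h \<Longrightarrow> h (f - g) = h f - h g"
  by (rule Modules.module_hom.diff) (simp add: Vector_Spaces.linear_iff_module_hom)

lemma pm_linear_id: "pm_linear (\<lambda>f. f)"
  by (rule pm_linearI) simp_all

lemma pm_linear_const_zero: "pm_linear (\<lambda>f. 0)"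
  by (rule pm_linearI) simp_all

lemma pm_linear_compose: "pm_linear g \<Longrightarrow> pm_linear h \<Longrightarrow> pm_linear (\<lambda>f. h (g f))"
  by (rule pm_linearI) (simp_all add: pm_linear_add pm_linear_scale)

lemma pm_linear_scaled: "pm_linear h \<Longrightarrow> pm_linear (\<lambda>f. pm_scale c (h f))"
  by (rule pm_linearI)
    (simp_all add: pm_linear_add pm_linear_scale pm.scale_right_distrib mult.commute)

lemma pm_linear_sum_fun: "(\<And>i. i \<in> A \<Longrightarrow> pm_linear (h i)) \<Longrightarrow> pm_linear (\<lambda>f. \<Sum>i\<in>A. h i f)"
  by (rule pm_linearI) (simp_all add: pm_linear_add pm_linear_scale sum.distrib pm.scale_sum_right)

lemma keys_pm_scale: "Poly_Mapping.keys (pm_scale c f) \<subseteq> Poly_Mapping.keys f"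
  by (auto simp: in_keys_iff)

lemma pm_expand:
  "f = (\<Sum>x\<in>Poly_Mapping.keys f. pm_scale (Poly_Mapping.lookup f x) (Poly_Mapping.single x 1))"
  by (rule poly_mapping_eqI)
    (simp add: lookup_sum lookup_single when_def in_keys_iff if_distrib cong: if_cong)

lemma pm_linear_eqI:
  fixes g h :: "('a \<Rightarrow>\<^sub>0 'c::field) \<Rightarrow> ('b \<Rightarrow>\<^sub>0 'c)"
  assumes "pm_linear g" "pm_linear h"
    and "\<And>x. x \<in> Poly_Mapping.keys f \<Longrightarrow>
      g (Poly_Mapping.single x 1) = h (Poly_Mapping.single x 1)"
  shows "g f = h f"
proof -
  have expand: "k f = (\<Sum>x\<in>Poly_Mapping.keys f.
      pm_scale (Poly_Mapping.lookup f x) (k (Poly_Mapping.single x 1)))" if "pm_linear k"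
    for k :: "('a \<Rightarrow>\<^sub>0 'c) \<Rightarrow> ('b \<Rightarrow>\<^sub>0 'c)"
    by (subst (1) pm_expand[of f])
      (simp add: pm_linear_sum[OF that] pm_linear_scale[OF that] del: pm_scale_single)
  show ?thesis
    using expand[OF assms(1)] expand[OF assms(2)] assms(3) by (simp cong: sum.cong)
qed

definition lin_ext :: "('b \<Rightarrow> ('c \<Rightarrow>\<^sub>0 'k::field)) \<Rightarrow> ('b \<Rightarrow>\<^sub>0 'k) \<Rightarrow> ('c \<Rightarrow>\<^sub>0 'k)" where
  "lin_ext F f = (\<Sum>x\<in>Poly_Mapping.keys f. pm_scale (Poly_Mapping.lookup f x) (F x))"

lemma lin_ext_superset:
  assumes "finite A" "Poly_Mapping.keys f \<subseteq> A"
  shows "lin_ext F f = (\<Sum>x\<in>A. pm_scale (Poly_Mapping.lookup f x) (F x))"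
  unfolding lin_ext_def using assms by (intro sum.mono_neutral_left) (auto simp: in_keys_iff)

lemma pm_linear_lin_ext:
  fixes F :: "'b \<Rightarrow> ('c \<Rightarrow>\<^sub>0 'k::field)"
  shows "pm_linear (lin_ext F)"
proof (rule pm_linearI)
  fix f g :: "'b \<Rightarrow>\<^sub>0 'k" and c :: 'k
  let ?A = "Poly_Mapping.keys f \<union> Poly_Mapping.keys g"
  have "lin_ext F (f + g) = (\<Sum>x\<in>?A. pm_scale (Poly_Mapping.lookup (f + g) x) (F x))"
    by (rule lin_ext_superset) (simp_all add: Poly_Mapping.keys_add)
  also have "\<dots> = (\<Sum>x\<in>?A. pm_scale (Poly_Mapping.lookup f x) (F x))
      + (\<Sum>x\<in>?A. pm_scale (Poly_Mapping.lookup g x) (F x))"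
    by (simp only: lookup_add pm.scale_left_distrib sum.distrib)
  also have "\<dots> = lin_ext F f + lin_ext F g"
    using lin_ext_superset[of ?A f F] lin_ext_superset[of ?A g F] by simp
  finally show "lin_ext F (f + g) = lin_ext F f + lin_ext F g" .
  have "lin_ext F (pm_scale c f)
      = (\<Sum>x\<in>Poly_Mapping.keys f. pm_scale (Poly_Mapping.lookup (pm_scale c f) x) (F x))"
    by (rule lin_ext_superset) (simp_all add: keys_pm_scale)
  also have "\<dots> = pm_scale c (lin_ext F f)"
    by (simp add: lin_ext_def pm.scale_sum_right)
  finally show "lin_ext F (pm_scale c f) = pm_scale c (lin_ext F f)" .
qed

lemma lin_ext_single [simp]: "lin_ext F (Poly_Mapping.single x c) = pm_scale c (F x)"
  by (cases "c = 0") (simp_all add: lin_ext_def)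

lemma lin_ext_zero [simp]: "lin_ext F 0 = 0"
  by (simp add: lin_ext_def)

lemma keys_lin_ext:
  "Poly_Mapping.keys (lin_ext F f) \<subseteq> (\<Union>x\<in>Poly_Mapping.keys f. Poly_Mapping.keys (F x))"
proof -
  have "Poly_Mapping.keys (lin_ext F f)
    \<subseteq> (\<Union>x\<in>Poly_Mapping.keys f. Poly_Mapping.keys (pm_scale (Poly_Mapping.lookup f x) (F x)))"
    unfolding lin_ext_def by (rule Poly_Mapping.keys_sum)
  also have "\<dots> \<subseteq> (\<Union>x\<in>Poly_Mapping.keys f. Poly_Mapping.keys (F x))"
    by (intro UN_mono order_refl keys_pm_scale)
  finally show ?thesis .
qed

lemma in_keys_lin_extI:
  assumes "x \<in> Poly_Mapping.keys f" "y \<in> Poly_Mapping.keys (F x)"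
    and "\<And>x'. x' \<in> Poly_Mapping.keys f \<Longrightarrow> x' \<noteq> x \<Longrightarrow> y \<notin> Poly_Mapping.keys (F x')"
  shows "y \<in> Poly_Mapping.keys (lin_ext F f)"
proof -
  have "Poly_Mapping.lookup (lin_ext F f) y
      = (\<Sum>z\<in>Poly_Mapping.keys f. Poly_Mapping.lookup f z * Poly_Mapping.lookup (F z) y)"
    by (simp add: lin_ext_def lookup_sum)
  also have "\<dots> = (\<Sum>z\<in>{x}. Poly_Mapping.lookup f z * Poly_Mapping.lookup (F z) y)"
    using assms(1,3) by (intro sum.mono_neutral_right) (auto simp: in_keys_iff)
  also have "\<dots> \<noteq> 0"
    using assms(1,2) by (simp add: in_keys_iff)
  finally show ?thesis
    by (simp add: in_keys_iff)
qed


text \<open>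
  The form in which leading terms are used: a basis element that occurs in exactly one summand cannot
  be cancelled.
\<close>

lemma in_keys_sumI:
  assumes "finite A" "a \<in> A" "y \<in> Poly_Mapping.keys (F a)"
    and "\<And>b. b \<in> A \<Longrightarrow> b \<noteq> a \<Longrightarrow> y \<notin> Poly_Mapping.keys (F b)"
  shows "y \<in> Poly_Mapping.keys (\<Sum>b\<in>A. F b)"
proof -
  have "Poly_Mapping.lookup (\<Sum>b\<in>A. F b) y = (\<Sum>b\<in>{a}. Poly_Mapping.lookup (F b) y)"
    unfolding lookup_sum using assms by (intro sum.mono_neutral_right) (auto simp: in_keys_iff)
  then show ?thesis
    using assms(3) by (simp add: in_keys_iff)
qed

lemma keys_pm_scale_eq: "c \<noteq> 0 \<Longrightarrow> Poly_Mapping.keys (pm_scale c f) = Poly_Mapping.keys f"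
  by (auto simp: in_keys_iff)

lemma pm_linear_comp_lin_ext:
  assumes "pm_linear h"
  shows "h (lin_ext F f) = lin_ext (\<lambda>x. h (F x)) f"
  unfolding lin_ext_def by (simp add: pm_linear_sum[OF assms] pm_linear_scale[OF assms])

lemma lin_ext_cong: "(\<And>x. x \<in> Poly_Mapping.keys f \<Longrightarrow> F x = G x) \<Longrightarrow> lin_ext F f = lin_ext G f"
  unfolding lin_ext_def by (intro sum.cong) simp_all

lemma lin_ext_singles: "lin_ext (\<lambda>x. Poly_Mapping.single x 1) f = f"
  unfolding lin_ext_def by (rule pm_expand[symmetric])

lemma lin_ext_diff: "lin_ext (\<lambda>x. F x - G x) f = lin_ext F f - lin_ext G f"
  unfolding lin_ext_def by (simp add: pm.scale_right_diff_distrib sum_subtractf)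


section \<open>The path algebra is a ring\<close>

abbreviation path_mult ::
  "(('v, 'a) qpath \<Rightarrow>\<^sub>0 'k::field) \<Rightarrow> (('v, 'a) qpath \<Rightarrow>\<^sub>0 'k) \<Rightarrow> (('v, 'a) qpath \<Rightarrow>\<^sub>0 'k)"
  where "path_mult f g \<equiv> lin_ext (\<lambda>p. lin_ext (\<lambda>q. path_prod p q 1) g) f"

lemma path_prod_scale: "path_prod p q c = pm_scale c (path_prod p q (1 :: 'k::field))"
  by (cases p; cases q) (auto intro!: poly_mapping_eqI simp: lookup_single when_def)

lemma mult_path_algebra: "f \<otimes>\<^bsub>path_algebra K Q\<^esub> g = path_mult f g"
  unfolding path_algebra_def lin_ext_def
  by (simp add: pm.scale_sum_right)
    (subst path_prod_scale, simp)

lemma pm_linear_path_mult_left: "pm_linear (\<lambda>f. path_mult f g)"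
  by (rule pm_linear_lin_ext)

lemma pm_linear_path_mult_right: "pm_linear (\<lambda>g. path_mult f g)"
  by (subst lin_ext_def)
    (intro pm_linear_sum_fun pm_linear_scaled pm_linear_lin_ext)

lemma path_mult_single [simp]:
  "path_mult (Poly_Mapping.single p c) (Poly_Mapping.single q d) = path_prod p q (c * d)"
  by (simp add: path_prod_scale[of p q "c * d"])

lemma path_mult_assoc: "path_mult (path_mult f g) h = path_mult f (path_mult g h)"
proof (rule pm_linear_eqI[of "\<lambda>f. path_mult (path_mult f g) h" "\<lambda>f. path_mult f (path_mult g h)"])
  fix p
  let ?s = "\<lambda>x. Poly_Mapping.single x (1::'c)"
  show "path_mult (path_mult (?s p) g) h = path_mult (?s p) (path_mult g h)"
  proof (rule pm_linear_eqI[of "\<lambda>g. path_mult (path_mult (?s p) g) h"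
        "\<lambda>g. path_mult (?s p) (path_mult g h)"])
    fix q
    show "path_mult (path_mult (?s p) (?s q)) h = path_mult (?s p) (path_mult (?s q) h)"
    proof (rule pm_linear_eqI[of "\<lambda>h. path_mult (path_mult (?s p) (?s q)) h"
          "\<lambda>h. path_mult (?s p) (path_mult (?s q) h)"])
      fix r
      show "path_mult (path_mult (?s p) (?s q)) (?s r) = path_mult (?s p) (path_mult (?s q) (?s r))"
        by (cases p; cases q; cases r) auto
    qed (rule pm_linear_path_mult_right
        pm_linear_compose[OF pm_linear_path_mult_right pm_linear_path_mult_right])+
  qed (rule pm_linear_compose[OF pm_linear_path_mult_right pm_linear_path_mult_left]
      pm_linear_compose[OF pm_linear_path_mult_left pm_linear_path_mult_right])+
qed (rule pm_linear_compose[OF pm_linear_path_mult_left pm_linear_path_mult_left]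
    pm_linear_path_mult_left)+

lemma keys_path_mult:
  "Poly_Mapping.keys (path_mult f g)
    \<subseteq> {(u, p @ q, x) | u p v q x. (u, p, v) \<in> Poly_Mapping.keys f \<and> (v, q, x) \<in> Poly_Mapping.keys g}"
    (is "_ \<subseteq> ?S")
proof
  fix r assume "r \<in> Poly_Mapping.keys (path_mult f g)"
  then obtain P where P: "P \<in> Poly_Mapping.keys f"
    and "r \<in> Poly_Mapping.keys (lin_ext (\<lambda>q. path_prod P q 1) g)"
    using keys_lin_ext by fast
  then obtain R where R: "R \<in> Poly_Mapping.keys g"
    and "r \<in> Poly_Mapping.keys (path_prod P R (1::'c))"
    using keys_lin_ext by fast
  then show "r \<in> ?S"
    using P by (cases P; cases R) (auto split: if_splits)
qed

lemma path_algebra_simps: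
  "carrier (path_algebra K Q) = {f. Poly_Mapping.keys f \<subseteq> qpaths Q}"
  "\<one>\<^bsub>path_algebra K Q\<^esub> = (\<Sum>v\<in>verts Q. trivial_path v)"
  "\<zero>\<^bsub>path_algebra K Q\<^esub> = 0"
  "f \<oplus>\<^bsub>path_algebra K Q\<^esub> g = f + g"
  by (simp_all add: path_algebra_def)

context wf_digraph
begin

lemma qpaths_append:
  "(u, p, v) \<in> qpaths G \<Longrightarrow> (v, q, x) \<in> qpaths G \<Longrightarrow> (u, p @ q, x) \<in> qpaths G"
  by (simp add: qpaths_def)

lemma path_mult_closed:
  "Poly_Mapping.keys f \<subseteq> qpaths G \<Longrightarrow> Poly_Mapping.keys g \<subseteq> qpaths G
    \<Longrightarrow> Poly_Mapping.keys (path_mult f g) \<subseteq> qpaths G"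
  by (rule order_trans[OF keys_path_mult]) (auto intro: qpaths_append)

lemma trivial_path_mult_left:
  "path_mult (trivial_path v) (Poly_Mapping.single (u, p, w) c)
    = (if u = v then Poly_Mapping.single (u, p, w) c else 0)"
  by (simp add: trivial_path_def)

lemma trivial_path_mult_right:
  "path_mult (Poly_Mapping.single (u, p, w) c) (trivial_path v)
    = (if w = v then Poly_Mapping.single (u, p, w) c else 0)"
  by (simp add: trivial_path_def)

end

context fin_digraph
begin

lemma path_mult_one_left:
  assumes "Poly_Mapping.keys f \<subseteq> qpaths G"
  shows "path_mult (\<Sum>v\<in>verts G. trivial_path v) f = f"
proof (rule pm_linear_eqI[of "\<lambda>f. path_mult _ f" "\<lambda>f. f"])
  fix P assume "P \<in> Poly_Mapping.keys f"
  moreover obtain u p w where P: "P = (u, p, w)" by (cases P)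
  ultimately have "u \<in> verts G"
    using assms by (auto simp: qpaths_def)
  have "path_mult (\<Sum>v\<in>verts G. trivial_path v) (Poly_Mapping.single P 1)
     = (\<Sum>v\<in>verts G. path_mult (trivial_path v) (Poly_Mapping.single P 1))"
    by (rule pm_linear_sum[OF pm_linear_path_mult_left])
  also have "\<dots> = Poly_Mapping.single P 1"
    using \<open>u \<in> verts G\<close> unfolding P trivial_path_mult_left by simp
  finally show "path_mult (\<Sum>v\<in>verts G. trivial_path v) (Poly_Mapping.single P 1)
    = Poly_Mapping.single P 1" .
qed (rule pm_linear_path_mult_right pm_linear_id)+

lemma path_mult_one_right:
  assumes "Poly_Mapping.keys f \<subseteq> qpaths G"
  shows "path_mult f (\<Sum>v\<in>verts G. trivial_path v) = f"
proof (rule pm_linear_eqI[of "\<lambda>f. path_mult f _" "\<lambda>f. f"])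
  fix P assume "P \<in> Poly_Mapping.keys f"
  moreover obtain u p w where P: "P = (u, p, w)" by (cases P)
  ultimately have "w \<in> verts G"
    using assms by (auto simp: qpaths_def)
  have "path_mult (Poly_Mapping.single P 1) (\<Sum>v\<in>verts G. trivial_path v)
     = (\<Sum>v\<in>verts G. path_mult (Poly_Mapping.single P 1) (trivial_path v))"
    by (rule pm_linear_sum[OF pm_linear_path_mult_right])
  also have "\<dots> = Poly_Mapping.single P 1"
    using \<open>w \<in> verts G\<close> unfolding P trivial_path_mult_right by simp
  finally show "path_mult (Poly_Mapping.single P 1) (\<Sum>v\<in>verts G. trivial_path v)
    = Poly_Mapping.single P 1" .
qed (rule pm_linear_path_mult_left pm_linear_id)+

lemma keys_one:
  "Poly_Mapping.keys (\<Sum>v\<in>verts G. trivial_path v :: ('a, 'b) qpath \<Rightarrow>\<^sub>0 'k::field) \<subseteq> qpaths G"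
proof -
  have "Poly_Mapping.keys (\<Sum>v\<in>verts G. trivial_path v :: ('a, 'b) qpath \<Rightarrow>\<^sub>0 'k)
    \<subseteq> (\<Union>v\<in>verts G. Poly_Mapping.keys (trivial_path v :: ('a, 'b) qpath \<Rightarrow>\<^sub>0 'k))"
    by (rule Poly_Mapping.keys_sum)
  also have "\<dots> \<subseteq> qpaths G"
    by (auto simp: trivial_path_def qpaths_def awalk_Nil_iff split: if_splits)
  finally show ?thesis .
qed

lemma ring_path_algebra: "ring (path_algebra K G)"
proof (rule ringI)
  show "abelian_group (path_algebra K G)"
  proof (rule abelian_groupI)
    fix f assume "f \<in> carrier (path_algebra K G)"
    then show "\<exists>g\<in>carrier (path_algebra K G). g \<oplus>\<^bsub>path_algebra K G\<^esub> f = \<zero>\<^bsub>path_algebra K G\<^esub>"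
      by (intro bexI[of _ "- f"]) (auto simp: path_algebra_simps)
  next
    fix f g assume "f \<in> carrier (path_algebra K G)" "g \<in> carrier (path_algebra K G)"
    then show "f \<oplus>\<^bsub>path_algebra K G\<^esub> g \<in> carrier (path_algebra K G)"
      using Poly_Mapping.keys_add[of f g] by (auto simp: path_algebra_simps)
  qed (auto simp: path_algebra_simps algebra_simps)
  show "monoid (path_algebra K G)"
    by (rule monoidI)
      (auto simp: path_algebra_simps mult_path_algebra path_mult_assoc path_mult_one_left
        path_mult_one_right keys_one[THEN subsetD] dest: path_mult_closed[THEN subsetD, rotated 2])
qed (simp_all add: path_algebra_simps mult_path_algebra
    pm_linear_add[OF pm_linear_path_mult_left] pm_linear_add[OF pm_linear_path_mult_right])

end

lemma (in fin_digraph) path_algebra_minus: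
  assumes "f \<in> carrier (path_algebra K G)"
  shows "\<ominus>\<^bsub>path_algebra K G\<^esub> f = - f"
proof -
  interpret A: ring "path_algebra K G"
    by (rule ring_path_algebra)
  show ?thesis
    by (rule A.minus_equality) (use assms in \<open>auto simp: path_algebra_simps\<close>)
qed

section \<open>Choosing an arrow at every vertex\<close>

text \<open>
  A double quiver with its reversal of arrows. Even a loop differs from its reverse.
\<close>

locale bar_quiver = fin_digraph Q for Q :: "('v, 'b) pre_digraph" +
  fixes bar :: "'b \<Rightarrow> 'b"
  assumes bar_arcs: "e \<in> arcs Q \<Longrightarrow> bar e \<in> arcs Q"
    and bar_bar [simp]: "bar (bar e) = e"
    and bar_neq: "bar e \<noteq> e"
    and tail_bar [simp]: "tail Q (bar e) = head Q e"
begin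

lemma head_bar [simp]: "head Q (bar e) = tail Q e"
  by (metis bar_bar tail_bar)

lemma bar_arcs_iff [simp]: "bar e \<in> arcs Q \<longleftrightarrow> e \<in> arcs Q"
  using bar_arcs bar_bar by metis

text \<open>
  A choice of arrows on part of the vertices that contains no arrow together with its reverse. The
  chosen arrows do not lead out of \<open>U\<close>; this is what keeps later choices from clashing with the
  earlier ones.
\<close>

definition orients :: "'v set \<Rightarrow> ('v \<Rightarrow> 'b) \<Rightarrow> bool" where
  "orients U c \<longleftrightarrow>
    (\<forall>v\<in>U. c v \<in> arcs Q \<and> tail Q (c v) = v \<and> head Q (c v) \<in> U) \<and>
    (\<forall>v\<in>U. \<forall>w\<in>U. c w \<noteq> bar (c v))"

text \<open>
  Walk from a vertex outside \<open>U\<close> without ever turning back, until the walk first meets \<open>U\<close> or itself,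
  and choose at each vertex on the way the arrow by which the walk leaves it. Two of these arrows could
  only be reverse to each other if they were consecutive, which is turning back. An arrow chosen inside
  \<open>U\<close> stays inside, so it is not the reverse of an arrow that starts outside.
\<close>

lemma orients_extend:
  assumes deg: "\<And>v e. v \<in> verts Q \<Longrightarrow> \<exists>e'\<in>arcs Q. tail Q e' = v \<and> e' \<noteq> e"
    and U: "orients U c" "U \<subset> verts Q"
  shows "\<exists>U' c'. orients U' c' \<and> U \<subset> U' \<and> U' \<subseteq> verts Q"
proof -
  obtain v where v: "v \<in> verts Q" "v \<notin> U"
    using U(2) by blast
  have "\<forall>e\<in>arcs Q. \<exists>e'. e' \<in> arcs Q \<and> tail Q e' = head Q e \<and> e' \<noteq> bar e"
    using deg head_in_verts by blast
  then obtain g where g: "\<And>e. e \<in> arcs Q \<Longrightarrow> g e \<in> arcs Q"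
    "\<And>e. e \<in> arcs Q \<Longrightarrow> tail Q (g e) = head Q e" "\<And>e. e \<in> arcs Q \<Longrightarrow> g e \<noteq> bar e"
    by metis
  obtain a0 where a0: "a0 \<in> arcs Q" "tail Q a0 = v"
    using deg[OF v(1)] by blast
  define a where "a i = (g ^^ i) a0" for i
  have a_arcs: "a i \<in> arcs Q" for i
    unfolding a_def by (induction i) (simp_all add: a0 g)
  have a_Suc: "a (Suc i) = g (a i)" for i
    by (simp add: a_def)
  define x where "x i = tail Q (a i)" for i
  have head_a: "head Q (a i) = x (Suc i)" for i
    by (simp add: x_def a_Suc g(2) a_arcs)
  have x0: "x 0 = v"
    by (simp add: x_def a_def a0)
  have "\<exists>j. x j \<in> U \<union> x ` {..<j}"
  proof (rule ccontr)
    assume none: "\<nexists>j. x j \<in> U \<union> x ` {..<j}"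
    have "x i \<noteq> x j" if "i < j" for i j
      using none that by (metis UnI2 imageI lessThan_iff)
    then have "inj x"
      by (metis injI linorder_neqE_nat)
    moreover have "range x \<subseteq> verts Q"
      using a_arcs by (auto simp: x_def)
    ultimately show False
      using finite_verts finite_subset range_inj_infinite by blast
  qed
  then obtain j where j: "x j \<in> U \<union> x ` {..<j}"
    and first: "\<And>i. i < j \<Longrightarrow> x i \<notin> U \<union> x ` {..<i}"
    using exists_least_iff[of "\<lambda>j. x j \<in> U \<union> x ` {..<j}"] by blast
  have inj: "inj_on x {..<j}"
  proof (rule inj_onI)
    fix m n assume *: "m \<in> {..<j}" "n \<in> {..<j}" "x m = x n"
    have "x m \<notin> x ` {..<m}" "x n \<notin> x ` {..<n}"
      using first[of m] first[of n] * by simp_all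
    then show "m = n"
      using *(3) by (metis imageI lessThan_iff linorder_neqE_nat)
  qed
  have notU: "x i \<notin> U" if "i < j" for i
    using first that by blast
  have "j > 0"
    using j x0 v(2) by (cases j) auto
  define U' where "U' = U \<union> x ` {..<j}"
  define c' where "c' w = (if w \<in> U then c w else a (the_inv_into {..<j} x w))" for w
  have c'_x: "c' (x i) = a i" if "i < j" for i
    using that notU[OF that] by (simp add: c'_def the_inv_into_f_f[OF inj])
  have c'_U: "c' w = c w" if "w \<in> U" for w
    using that by (simp add: c'_def)
  have x_Suc: "x (Suc i) \<in> U'" if "i < j" for i
    using that j unfolding U'_def by (cases "Suc i = j") auto
  have new_old: "c w \<noteq> bar (a i)" if "w \<in> U" "i < j" for w i
  proof
    assume "c w = bar (a i)"
    then have "head Q (c w) = x i"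
      by (simp add: x_def)
    then show False
      using U(1) that notU unfolding orients_def by auto
  qed
  have new_new: "a n \<noteq> bar (a i)" if ni: "n < j" "i < j" for n i
  proof
    assume eq: "a n = bar (a i)"
    then have "x n = x (Suc i)" "x (Suc n) = x i"
      using head_a[of i] head_a[of n] by (simp_all add: x_def)
    then have "Suc i < j \<Longrightarrow> n = Suc i" "Suc n < j \<Longrightarrow> i = Suc n"
      using ni by (auto dest: inj_onD[OF inj])
    then have "n = Suc i \<or> i = Suc n \<or> i = n"
      using ni by (metis Suc_lessI Suc_inject)
    then consider "n = Suc i" | "i = Suc n" | "i = n"
      by blast
    then show False
      using eq bar_neq g(3)[OF a_arcs] a_Suc by cases (metis bar_bar)+
  qed
  have "orients U' c'"
    unfolding orients_def
  proof (intro conjI ballI)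
    fix w assume "w \<in> U'"
    then consider "w \<in> U" | i where "i < j" "w = x i"
      unfolding U'_def by blast
    then have "c' w \<in> arcs Q \<and> tail Q (c' w) = w \<and> head Q (c' w) \<in> U'"
    proof cases
      case 1
      then show ?thesis
        using U(1) by (auto simp: c'_U orients_def U'_def)
    next
      case 2
      then show ?thesis
        using x_Suc by (simp add: c'_x a_arcs head_a) (simp add: x_def)
    qed
    then show "c' w \<in> arcs Q" "tail Q (c' w) = w" "head Q (c' w) \<in> U'"
      by simp_all
  next
    fix u w assume "u \<in> U'" "w \<in> U'"
    then show "c' w \<noteq> bar (c' u)"
      using new_old new_new U(1) unfolding U'_def orients_def
      by (auto simp: c'_x c'_U) (metis bar_bar)
  qed
  moreover have "v \<in> U'"
    using \<open>j > 0\<close> x0 unfolding U'_def by force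
  moreover have "U' \<subseteq> verts Q"
    using U(2) a_arcs unfolding U'_def by (auto simp: x_def)
  ultimately show ?thesis
    using v(2) unfolding U'_def by (intro exI[of _ U'] exI[of _ c']) (auto simp: U'_def)
qed

lemma ex_orients:
  assumes "\<And>v e. v \<in> verts Q \<Longrightarrow> \<exists>e'\<in>arcs Q. tail Q e' = v \<and> e' \<noteq> e"
  shows "\<exists>c. orients (verts Q) c"
proof -
  have "\<exists>c. orients (verts Q) c" if "orients U c" "U \<subseteq> verts Q" for U c
    using that
  proof (induction "card (verts Q - U)" arbitrary: U c rule: less_induct)
    case less
    show ?case
    proof (cases "U = verts Q")
      case False
      then obtain U' c' where *: "orients U' c'" "U \<subset> U'" "U' \<subseteq> verts Q"
        using orients_extend[OF assms less.prems(1)] less.prems(2) by blast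
      then have "card (verts Q - U') < card (verts Q - U)"
        by (intro psubset_card_mono) auto
      then show ?thesis
        using less.hyps * by blast
    qed (use less.prems in blast)
  qed
  from this[of "{}"] show ?thesis
    by (simp add: orients_def)
qed

end

section \<open>Feeders of a vertex\<close>

lemma funpow_split: "k \<le> l \<Longrightarrow> (f ^^ l) x = (f ^^ (l - k)) ((f ^^ k) x)"
  by (metis comp_apply funpow_add le_add_diff_inverse2)

text \<open>
  The numbering \<open>rank\<close> is arbitrary and serves to compare arrows in values; the number 0 is left for a
  letter that is not an arrow.
\<close>

locale oriented_quiver = bar_quiver +
  fixes c :: "'a \<Rightarrow> 'b" and rank :: "'b \<Rightarrow> nat"
  assumes orients_c: "orients (verts Q) c"
    and other_arc: "v \<in> verts Q \<Longrightarrow> \<exists>e\<in>arcs Q. tail Q e = v \<and> e \<noteq> c v"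
    and rank_inj: "inj_on rank (arcs Q)"
    and rank_pos: "e \<in> arcs Q \<Longrightarrow> rank e > 0"
begin

lemma c_arcs [simp]: "v \<in> verts Q \<Longrightarrow> c v \<in> arcs Q"
  and tail_c [simp]: "v \<in> verts Q \<Longrightarrow> tail Q (c v) = v"
  and c_neq_bar: "v \<in> verts Q \<Longrightarrow> w \<in> verts Q \<Longrightarrow> c w \<noteq> bar (c v)"
  using orients_c unfolding orients_def by auto

definition chosen :: "'b \<Rightarrow> bool" where
  "chosen e \<longleftrightarrow> e \<in> c ` verts Q"

lemma chosen_iff: "e \<in> arcs Q \<Longrightarrow> chosen e \<longleftrightarrow> e = c (tail Q e)"
  unfolding chosen_def by (auto intro: rev_image_eqI)

lemma chosen_c [simp]: "v \<in> verts Q \<Longrightarrow> chosen (c v)"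
  by (simp add: chosen_def)

lemma chosen_bar: "chosen e \<Longrightarrow> \<not> chosen (bar e)"
  using c_neq_bar unfolding chosen_def by (metis imageE)

definition free_arcs :: "'b set" where
  "free_arcs = {e \<in> arcs Q. \<not> chosen e \<and> \<not> chosen (bar e)}"

definition step :: "'a \<Rightarrow> 'a" where
  "step v = head Q (c v)"

lemma step_verts [simp]: "v \<in> verts Q \<Longrightarrow> step v \<in> verts Q"
  by (simp add: step_def)

lemma funpow_step_verts [simp]: "v \<in> verts Q \<Longrightarrow> (step ^^ n) v \<in> verts Q"
  by (induction n) simp_all

definition cyclic :: "'a \<Rightarrow> bool" where
  "cyclic v \<longleftrightarrow> (\<exists>n>0. (step ^^ n) v = v)"

lemma cyclic_step: "cyclic v \<Longrightarrow> cyclic (step v)"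
  unfolding cyclic_def by (metis funpow_swap1)

lemma cyclic_funpow: "cyclic v \<Longrightarrow> cyclic ((step ^^ n) v)"
  by (induction n) (simp_all add: cyclic_step)

lemma cyclic_pred: "cyclic v \<Longrightarrow> \<exists>w. cyclic w \<and> step w = v \<and> (\<exists>n. w = (step ^^ n) v)"
proof -
  assume v: "cyclic v"
  then obtain n where n: "n > 0" "(step ^^ n) v = v"
    unfolding cyclic_def by blast
  have "step ((step ^^ (n - 1)) v) = v"
    using n by (metis Suc_diff_1 funpow.simps(2) comp_apply)
  then show ?thesis
    using cyclic_funpow[OF v] by blast
qed

text \<open>
  A map permutes its periodic points: applying it often enough undoes one step.
\<close>

lemma cyclic_step_inj:
  assumes "cyclic v" "cyclic w" "step v = step w"
  shows "v = w"
proof -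
  obtain m n where m: "m > 0" "(step ^^ m) v = v" and n: "n > 0" "(step ^^ n) w = w"
    using assms(1,2) unfolding cyclic_def by blast
  have mult: "(step ^^ (k * l)) u = u" if "(step ^^ k) u = u" for k l u
    using that by (induction l) (simp_all add: funpow_add)
  have shift: "(step ^^ k) u = (step ^^ (k - 1)) (step u)" if "k > 0" for k u
    using that by (metis Suc_diff_1 funpow_Suc_right comp_apply)
  \<comment> \<open>\<open>m * n\<close> is a common period of the two points.\<close>
  have pos: "m * n > 0"
    using m n by simp
  have "v = (step ^^ (m * n)) v"
    using mult[OF m(2)] by simp
  also have "\<dots> = (step ^^ (m * n - 1)) (step v)"
    using shift[OF pos] .
  also have "\<dots> = (step ^^ (m * n)) w"
    using shift[OF pos, of w] assms(3) by simp
  also have "\<dots> = w"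
    using mult[OF n(2), of m] by (simp add: mult.commute)
  finally show ?thesis .
qed

text \<open>
  The free arrows that start upstream of \<open>v\<close>, with the number of chosen arrows from their tail to \<open>v\<close>.
  These are the arrows that remain when \<open>c v (c v)\<^sup>*\<close> is rewritten at \<open>v\<close> and then further upstream.
\<close>

definition feeders :: "'a \<Rightarrow> ('b \<times> nat) set" where
  "feeders v = {(e, k). e \<in> free_arcs \<and> (step ^^ k) (tail Q e) = v}"

lemma feeders_step: "(e, k) \<in> feeders w \<Longrightarrow> (e, Suc k) \<in> feeders (step w)"
  by (simp add: feeders_def)

lemma feeder_depth_unique:
  assumes "(e, k) \<in> feeders v" "(e, l) \<in> feeders v" "\<not> cyclic v"
  shows "k = l"
proof -
  have "\<not> k < l" if "(e, k) \<in> feeders v" "(e, l) \<in> feeders v" for k l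
  proof
    assume "k < l"
    have "(step ^^ k) (tail Q e) = v" "(step ^^ l) (tail Q e) = v"
      using that by (simp_all add: feeders_def)
    then have "(step ^^ (l - k)) v = v"
      using funpow_split[of k l step "tail Q e"] \<open>k < l\<close> by (metis less_imp_le)
    then show False
      using \<open>k < l\<close> assms(3) unfolding cyclic_def by (metis zero_less_diff)
  qed
  then show ?thesis
    using assms by (meson linorder_neqE_nat)
qed

lemma acyclic_funpow_bounded:
  assumes "(step ^^ k) z = v" "z \<in> verts Q" "\<not> cyclic v"
  shows "k < card (verts Q)"
proof (rule ccontr)
  assume "\<not> k < card (verts Q)"
  have "\<not> inj_on (\<lambda>i. (step ^^ i) z) {..k}"
  proof
    assume "inj_on (\<lambda>i. (step ^^ i) z) {..k}"
    then have "card {..k} \<le> card (verts Q)"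
      by (rule card_inj_on_le) (use assms(2) in auto)
    then show False
      using \<open>\<not> k < card (verts Q)\<close> by simp
  qed
  then obtain i j where "i < j" "j \<le> k" "(step ^^ i) z = (step ^^ j) z"
    unfolding inj_on_def by (metis atMost_iff linorder_neqE_nat)
  then have "(step ^^ (j - i)) ((step ^^ i) z) = (step ^^ i) z"
    using funpow_split[of i j step z] by (metis less_imp_le)
  then have "cyclic ((step ^^ i) z)"
    using \<open>i < j\<close> unfolding cyclic_def by (metis zero_less_diff)
  then have "cyclic ((step ^^ (k - i)) ((step ^^ i) z))"
    by (rule cyclic_funpow)
  then show False
    using assms \<open>i < j\<close> \<open>j \<le> k\<close> funpow_split[of i k step z] by (metis less_imp_le order.trans)
qed

text \<open>
  Go upstream from \<open>v\<close> as far as possible, which is finitely far as \<open>v\<close> is not cyclic. At the vertex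
  reached, no chosen arrow arrives, so the second arrow that leaves it is free.
\<close>

lemma feeders_nonempty:
  assumes "v \<in> verts Q" "\<not> cyclic v"
  shows "feeders v \<noteq> {}"
proof -
  \<comment> \<open>The distances from which \<open>v\<close> can be reached.\<close>
  define P where "P k \<longleftrightarrow> (\<exists>z\<in>verts Q. (step ^^ k) z = v)" for k
  have P0: "P 0"
    using assms by (simp add: P_def)
  have bound: "\<forall>k. P k \<longrightarrow> k \<le> card (verts Q)"
    using acyclic_funpow_bounded[OF _ _ assms(2)] unfolding P_def by (blast intro: less_imp_le)
  define k where "k = (GREATEST k. P k)"
  have "P k"
    unfolding k_def using GreatestI_nat[of P 0] P0 bound by blast
  have maximal: "\<not> P (Suc k)"
    using Greatest_le_nat[of P "Suc k" "card (verts Q)"] bound unfolding k_def by auto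
  obtain z where z: "z \<in> verts Q" "(step ^^ k) z = v"
    using \<open>P k\<close> unfolding P_def by blast
  obtain e where e: "e \<in> arcs Q" "tail Q e = z" "e \<noteq> c z"
    using other_arc[OF z(1)] by blast
  have "\<not> chosen (bar e)"
  proof
    assume "chosen (bar e)"
    then have "step (head Q e) = z"
      using e chosen_iff[of "bar e"] by (metis bar_arcs head_bar step_def tail_bar)
    then have "P (Suc k)"
      unfolding P_def using z(2) e(1) head_in_verts by (metis comp_apply funpow_Suc_right)
    then show False
      using maximal by blast
  qed
  then have "(e, k) \<in> feeders v"
    using e z chosen_iff[OF e(1)] by (simp add: feeders_def free_arcs_def)
  then show ?thesis
    by blast
qed

definition top_feeder :: "'a \<Rightarrow> 'b \<times> nat" where
  "top_feeder v = arg_max (\<lambda>x. rank (fst x)) (\<lambda>x. x \<in> feeders v)"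

lemma top_feeder:
  assumes "v \<in> verts Q" "\<not> cyclic v"
  shows "top_feeder v \<in> feeders v"
    and "(e, k) \<in> feeders v \<Longrightarrow> rank e \<le> rank (fst (top_feeder v))"
proof -
  have "finite (rank ` arcs Q)"
    by simp
  then obtain b where b: "\<forall>n\<in>rank ` arcs Q. n < b"
    using finite_nat_set_iff_bounded by blast
  have b': "\<forall>x. x \<in> feeders v \<longrightarrow> rank (fst x) < b"
    using b by (auto simp: feeders_def free_arcs_def)
  obtain x where x: "x \<in> feeders v"
    using feeders_nonempty[OF assms] by blast
  note am = arg_max_nat_lemma[of "\<lambda>x. x \<in> feeders v" x "\<lambda>x. rank (fst x)" b, OF x b']
  show "top_feeder v \<in> feeders v"
    using am unfolding top_feeder_def by blast
  show "(e, k) \<in> feeders v \<Longrightarrow> rank e \<le> rank (fst (top_feeder v))"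
    using am unfolding top_feeder_def by fastforce
qed

end

section \<open>Values of words\<close>

lemma lenlex_less_append:
  fixes xs ys :: "'l::linorder list"
  assumes "xs < ys"
  shows "us @ xs @ vs < us @ ys @ vs"
  using assms unfolding list_less_def lenlex_conv
  by (auto intro: lex_append_leftI lex_append_rightI)

lemma lenlex_less_map:
  fixes xs ys :: "'l::linorder list"
  assumes "strict_mono f" "xs < ys"
  shows "map f xs < map f ys"
proof -
  consider "length xs < length ys" | "length xs = length ys" "(xs, ys) \<in> lex {(u, v). u < v}"
    using assms(2) unfolding list_less_def lenlex_conv by auto
  then show ?thesis
  proof cases
    case 2
    then obtain zs x y xs' ys' where "xs = zs @ x # xs'" "ys = zs @ y # ys'" "x < y"
      unfolding lex_conv by auto
    moreover from this have "length xs' = length ys'"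
      using 2(1) by simp
    ultimately have "(map f xs, map f ys) \<in> lex {(u, v). u < v}"
      using strict_monoD[OF assms(1)] by (auto intro!: lex_append_leftI)
    then show ?thesis
      using 2 by (simp add: list_less_def lenlex_conv)
  qed (simp add: list_less_def lenlex_conv)
qed

context oriented_quiver
begin

fun normal :: "'b list \<Rightarrow> bool" where
  "normal (e # e' # p) \<longleftrightarrow> \<not> (chosen e \<and> e' = bar e) \<and> normal (e' # p)"
| "normal p \<longleftrightarrow> True"

lemma normal_ConsD: "normal (e # p) \<Longrightarrow> normal p"
  by (cases p) simp_all

lemma normal_Cons: "normal (e # p) \<longleftrightarrow> normal p \<and> \<not> (chosen e \<and> p \<noteq> [] \<and> hd p = bar e)"
  by (cases p) auto

text \<open>
  The \<open>t\<close>-degree of an arrow.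
\<close>

definition rise :: "'b \<Rightarrow> int" where
  "rise e = (if chosen e then 1 else if chosen (bar e) then - 1 else 0)"

text \<open>
  The letters that an arrow contributes to the value of a path when it is passed at \<open>t\<close>-degree \<open>h\<close>. A
  letter \<open>(rank f, h)\<close> stands for \<open>t\<^sup>h f t\<^sup>-\<^sup>h\<close>, and \<open>(0, 0)\<close> is the letter fixed by \<open>t\<close>, which no arrow
  has as its rank is positive. A reverse of a chosen arrow \<open>c v\<close> contributes what the leading term
  of \<open>e e\<^sup>*\<close>, \<open>e \<noteq> c v\<close>, contributes at \<open>t\<close>-degree \<open>h - 1\<close>; the feeder starts \<open>k\<close> steps upstream, hence at degree
  \<open>h - 1 - k\<close>. Three copies of \<open>(0, 0)\<close> are needed in order to exceed every two letters of a feeder.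
\<close>

definition letters :: "int \<Rightarrow> 'b \<Rightarrow> (nat \<times> int) list" where
  "letters h e =
    (if chosen e then []
     else if chosen (bar e) then
       (if cyclic (head Q e) then [(0, 0), (0, 0), (0, 0)]
        else case top_feeder (head Q e) of (f, k) \<Rightarrow>
          [(rank f, h - 1 - int k), (rank (bar f), h - 1 - int k)])
     else [(rank e, h)])"

primrec word :: "int \<Rightarrow> 'b list \<Rightarrow> (nat \<times> int) list" where
  "word h [] = []"
| "word h (e # p) = letters h e @ word (h + rise e) p"

definition height :: "'b list \<Rightarrow> int" where
  "height p = (\<Sum>e\<leftarrow>p. rise e)"

definition val :: "'b list \<Rightarrow> int \<times> (nat \<times> int) list" where
  "val p = (height p, word 0 p)"

lemma height_simps [simp]:
  "height [] = 0" "height (e # p) = rise e + height p" "height (p @ q) = height p + height q"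
  by (simp_all add: height_def)

lemma word_append: "word h (p @ q) = word h p @ word (h + height p) q"
  by (induction p arbitrary: h) (simp_all add: add.assoc)

lemma free_arcs_rank: "e \<in> free_arcs \<Longrightarrow> rank e > 0 \<and> rank (bar e) > 0"
  by (simp add: free_arcs_def rank_pos)

lemma top_feeder_free:
  "v \<in> verts Q \<Longrightarrow> \<not> cyclic v \<Longrightarrow> fst (top_feeder v) \<in> free_arcs"
  using top_feeder(1)[of v] by (auto simp: feeders_def split: prod.splits)

text \<open>
  Conjugation by \<open>t\<^sup>s\<close>.
\<close>

definition shift :: "int \<Rightarrow> nat \<times> int \<Rightarrow> nat \<times> int" where
  "shift s l = (if fst l = 0 then l else (fst l, snd l + s))"

lemma strict_mono_shift: "strict_mono (shift s)"
  by (rule strict_monoI) (auto simp: shift_def less_prod_def)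

lemma letters_shift:
  assumes "e \<in> arcs Q"
  shows "letters (h + s) e = map (shift s) (letters h e)"
proof -
  have "rank f > 0 \<and> rank (bar f) > 0" if "\<not> cyclic (head Q e)" "top_feeder (head Q e) = (f, k)"
    for f k
    using top_feeder_free[of "head Q e"] free_arcs_rank[of f] that assms by simp
  then show ?thesis
    using rank_pos[OF assms]
    by (auto simp: letters_def shift_def split: prod.split)
qed

lemma word_shift: "set p \<subseteq> arcs Q \<Longrightarrow> word (h + s) p = map (shift s) (word h p)"
proof (induction p arbitrary: h)
  case (Cons e p)
  then show ?case
    using Cons.IH[of "h + rise e"] by (simp add: letters_shift algebra_simps)
qed simp

text \<open>
  A prefix shifts all letters of the following word by its degree, and shifts are strictly increasing;
  since degrees are compared first, a suffix is shifted equally on both sides or is irrelevant.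
\<close>

lemma val_mono_strict:
  assumes "val q < val q'" "set q \<subseteq> arcs Q" "set q' \<subseteq> arcs Q"
  shows "val (p @ q @ r) < val (p @ q' @ r)"
proof -
  have "height q < height q' \<or> height q = height q' \<and> word 0 q < word 0 q'"
    using assms(1) by (auto simp: val_def less_prod_def)
  then consider "height q < height q'" | "height q = height q'" "word 0 q < word 0 q'"
    by blast
  then show ?thesis
  proof cases
    case 1
    then show ?thesis by (simp add: val_def less_prod_def)
  next
    case 2
    have "word (height p) q < word (height p) q'"
      using word_shift[OF assms(2), of 0 "height p"] word_shift[OF assms(3), of 0 "height p"]
        lenlex_less_map[OF strict_mono_shift 2(2)] by simp
    then show ?thesis
      using 2(1) lenlex_less_append by (simp add: val_def less_prod_def word_append)
  qed
qed

lemma val_cong: 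
  assumes "val q = val q'" "set q \<subseteq> arcs Q" "set q' \<subseteq> arcs Q"
  shows "val (p @ q @ r) = val (p @ q' @ r)"
proof -
  have "word (height p) q = word (height p) q'"
    using word_shift[OF assms(2), of 0 "height p"] word_shift[OF assms(3), of 0 "height p"] assms(1)
    by (simp add: val_def)
  then show ?thesis
    using assms(1) by (simp add: val_def word_append)
qed

lemma val_mono:
  assumes "val q \<le> val q'" "set q \<subseteq> arcs Q" "set q' \<subseteq> arcs Q"
  shows "val (p @ q @ r) \<le> val (p @ q' @ r)"
  using val_mono_strict[OF _ assms(2,3)] val_cong[OF _ assms(2,3)] assms(1)
  by (metis order_le_less)

section \<open>Distinct normal words have distinct values\<close>

text \<open>
  \<open>l\<close> is the first letter that the arrow \<open>b\<close>, which is not chosen, contributes when it leaves \<open>x\<close> at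
  \<open>t\<close>-degree \<open>h\<close>. In the first case \<open>l\<close> belongs to the feeder \<open>e\<close> that starts \<open>k\<close> steps upstream of \<open>x\<close>:
  for \<open>k = 0\<close> the arrow is \<open>e\<close> itself, otherwise it makes the first step back towards \<open>e\<close>. In the second
  case it makes a step back on a cycle.
\<close>

definition emits :: "int \<Rightarrow> 'a \<Rightarrow> 'b \<Rightarrow> nat \<times> int \<Rightarrow> bool" where
  "emits h x b l \<longleftrightarrow>
    (\<exists>e k. (e, k) \<in> feeders x \<and> l = (rank e, h - int k) \<and>
       b = (if k = 0 then e else bar (c ((step ^^ (k - 1)) (tail Q e))))) \<or>
    (\<exists>w. cyclic w \<and> step w = x \<and> l = (0, 0) \<and> b = bar (c w))"

lemma emits_letters:
  assumes "e \<in> arcs Q" "\<not> chosen e"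
  shows "letters h e \<noteq> []" "emits h (tail Q e) e (hd (letters h e))"
proof -
  show "letters h e \<noteq> []"
    using assms by (auto simp: letters_def split: prod.split)
  show "emits h (tail Q e) e (hd (letters h e))"
  proof (cases "chosen (bar e)")
    case False
    then have "(e, 0) \<in> feeders (tail Q e)"
      using assms by (simp add: feeders_def free_arcs_def)
    then show ?thesis
      using assms False unfolding emits_def by (auto simp: letters_def intro: exI[of _ 0])
  next
    case True
    define w where "w = head Q e"
    have w: "w \<in> verts Q" "bar e = c w"
      using True assms(1) chosen_iff[of "bar e"] by (simp_all add: w_def)
    then have e: "e = bar (c w)"
      by (metis bar_bar)
    have hd_cyclic: "cyclic w \<Longrightarrow> hd (letters h e) = (0, 0)"
      using True assms by (simp add: letters_def w_def)
    have step_w: "step w = tail Q e"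
      using w by (metis head_bar step_def)
    show ?thesis
    proof (cases "cyclic w")
      case c: True
      then show ?thesis
        using hd_cyclic e step_w unfolding emits_def by blast
    next
      case False
      obtain f k where f: "top_feeder w = (f, k)"
        by fastforce
      then have fk: "(f, k) \<in> feeders w"
        using top_feeder(1)[OF w(1) False] by simp
      have "hd (letters h e) = (rank f, h - int (Suc k))"
        using True False assms f by (simp add: letters_def w_def)
      moreover have "(f, Suc k) \<in> feeders (tail Q e)"
        using feeders_step[OF fk] step_w by simp
      moreover have "(step ^^ k) (tail Q f) = w"
        using fk by (simp add: feeders_def)
      ultimately have "(f, Suc k) \<in> feeders (tail Q e) \<and> hd (letters h e) = (rank f, h - int (Suc k))
          \<and> e = (if Suc k = 0 then f else bar (c ((step ^^ (Suc k - 1)) (tail Q f))))"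
        using e by (metis diff_Suc_1 nat.distinct(1))
      then show ?thesis
        unfolding emits_def by blast
    qed
  qed
qed

text \<open>
  Where an arrow and the letter that it contributes are known, the arrow is determined: a letter names
  its feeder, and the way back to the feeder is unique. If the same letter is contributed after \<open>m > 0\<close>
  further chosen arrows from \<open>x\<close>, then the way back leads through \<open>x\<close>, so the arrow undoes the last of
  these \<open>m\<close> steps. Normal words do not contain such a step.
\<close>

lemma emits_later:
  assumes "emits h x b l" "emits (h + int m) ((step ^^ m) x) b' l"
  shows "if m = 0 then b' = b else b' = bar (c ((step ^^ (m - 1)) x))"
proof -
  consider (free) e k e' k' where "(e, k) \<in> feeders x" "(e', k') \<in> feeders ((step ^^ m) x)"
      "l = (rank e, h - int k)" "l = (rank e', h + int m - int k')"
      "b = (if k = 0 then e else bar (c ((step ^^ (k - 1)) (tail Q e))))"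
      "b' = (if k' = 0 then e' else bar (c ((step ^^ (k' - 1)) (tail Q e'))))"
    | (cyclic) w w' where "cyclic w" "cyclic w'" "step w = x" "step w' = (step ^^ m) x"
      "b = bar (c w)" "b' = bar (c w')"
    using assms rank_pos unfolding emits_def
    by (auto simp: feeders_def free_arcs_def) fastforce+
  then show ?thesis
  proof cases
    case free
    have "e \<in> arcs Q" "e' \<in> arcs Q"
      using free(1,2) by (auto simp: feeders_def free_arcs_def)
    then have e': "e' = e"
      using free(3,4) rank_inj by (auto dest: inj_onD)
    have k': "k' = k + m"
      using free(3,4) by simp
    show ?thesis
    proof (cases "m = 0")
      case False
      then have "k' - 1 = m - 1 + k" "k' \<noteq> 0"
        using k' by simp_all
      then have "b' = bar (c ((step ^^ (m - 1)) ((step ^^ k) (tail Q e))))"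
        using free(6) e' by (simp add: funpow_add)
      then show ?thesis
        using free(1) False by (simp add: feeders_def)
    qed (use free e' k' in simp)
  next
    case cyclic
    show ?thesis
    proof (cases "m = 0")
      case True
      then show ?thesis
        using cyclic cyclic_step_inj by (metis funpow_0)
    next
      case False
      have "step ((step ^^ (m - 1)) x) = step w'"
        using False cyclic(4) by (metis Suc_diff_1 comp_apply funpow.simps(2) gr0I)
      moreover have "cyclic ((step ^^ (m - 1)) x)"
        using cyclic(1,3) cyclic_step cyclic_funpow by metis
      ultimately have "w' = (step ^^ (m - 1)) x"
        using cyclic_step_inj cyclic(2) by metis
      then show ?thesis
        using False cyclic(6) by simp
    qed
  qed
qed

text \<open>
  A normal word that has letters starts with a number \<open>m\<close> of chosen arrows, which contribute none, followed by an
  arrow \<open>b\<close> that contributes the first letter and does not undo the last of them.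
\<close>

lemma first_letter:
  assumes "awalk u p v" "normal p" "word h p \<noteq> []"
  shows "\<exists>m b. emits (h + int m) ((step ^^ m) u) b (hd (word h p)) \<and>
    (if m = 0 then hd p = b else hd p = c u \<and> b \<noteq> bar (c ((step ^^ (m - 1)) u)))"
  using assms
proof (induction p arbitrary: u h)
  case (Cons e p)
  have e: "e \<in> arcs Q" "tail Q e = u" and p: "awalk (head Q e) p v"
    using Cons.prems(1) by (auto simp: awalk_Cons_iff)
  show ?case
  proof (cases "chosen e")
    case False
    have "hd (word h (e # p)) = hd (letters h e)"
      using emits_letters(1)[OF e(1) False] by simp
    then have "emits h u e (hd (word h (e # p)))"
      using emits_letters(2)[OF e(1) False] e(2) by simp
    then show ?thesis
      by (intro exI[of _ 0] exI[of _ e]) simp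
  next
    case True
    then have eq: "e = c u" "head Q e = step u"
      using e chosen_iff[OF e(1)] by (simp_all add: step_def)
    have w: "word h (e # p) = word (h + 1) p"
      using True by (simp add: letters_def rise_def)
    then have "p \<noteq> []"
      using Cons.prems(3) by auto
    obtain m b where m: "emits (h + 1 + int m) ((step ^^ m) (step u)) b (hd (word (h + 1) p))"
      and b: "if m = 0 then hd p = b
        else hd p = c (step u) \<and> b \<noteq> bar (c ((step ^^ (m - 1)) (step u)))"
      using Cons.IH[of "step u" "h + 1"] p eq w Cons.prems normal_ConsD by metis
    have "b \<noteq> bar (c ((step ^^ m) u))"
    proof (cases "m = 0")
      case True
      then show ?thesis
        using b Cons.prems(2) \<open>chosen e\<close> \<open>p \<noteq> []\<close> eq(1) by (auto simp: normal_Cons)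
    next
      case False
      then have "(step ^^ (m - 1)) (step u) = (step ^^ m) u"
        by (metis Suc_diff_1 comp_apply funpow_Suc_right gr0I)
      then show ?thesis
        using b False by simp
    qed
    moreover have "emits (h + int (Suc m)) ((step ^^ Suc m) u) b (hd (word h (e # p)))"
      using m w by (simp add: funpow_swap1 algebra_simps)
    ultimately show ?thesis
      using eq(1) by (intro exI[of _ "Suc m"] exI[of _ b]) simp
  qed
qed simp

text \<open>
  If one of the words starts with an arrow that is not chosen, \<open>emits_later\<close> rules out that the other
  one reaches its first letter later; and otherwise both start with the same chosen arrow.
\<close>

lemma hd_determined:
  assumes p: "awalk u p v" "normal p" and q: "awalk u q w" "normal q"
    and eq: "word h p = word h q" "word h p \<noteq> []"
  shows "hd p = hd q"
proof -
  define good where "good p m b \<longleftrightarrow> emits (h + int m) ((step ^^ m) u) b (hd (word h p)) \<and>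
    (if m = 0 then hd p = b else hd p = c u \<and> b \<noteq> bar (c ((step ^^ (m - 1)) u)))" for p m b
  \<comment> \<open>Two normal words with the same first letter: if one emits it at once, so does the other.\<close>
  have zero: "n = 0 \<and> b' = b" if "good p 0 b" "good q n b'" "hd (word h p) = hd (word h q)"
    for p q n b b'
    using that emits_later[of h u b "hd (word h p)" n b'] unfolding good_def by (auto split: if_splits)
  obtain m b where m: "good p m b"
    using first_letter[OF p eq(2)] unfolding good_def by blast
  obtain n b' where n: "good q n b'"
    using first_letter[OF q, of h] eq unfolding good_def by auto
  show ?thesis
  proof (cases "m = 0 \<or> n = 0")
    case True
    then have "m = 0 \<and> n = 0 \<and> b = b'"
      using zero[of p b q n b'] zero[of q b' p m b] m n eq(1) by auto
    then show ?thesis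
      using m n unfolding good_def by simp
  next
    case False
    then show ?thesis
      using m n unfolding good_def by simp
  qed
qed

text \<open>
  Only chosen arrows contribute no letters, and each of them raises the degree by one.
\<close>

lemma word_Nil_height:
  assumes "set p \<subseteq> arcs Q" "word h p = []"
  shows "height p = int (length p)"
  using assms
proof (induction p arbitrary: h)
  case (Cons e p)
  have "chosen e"
    using Cons.prems emits_letters(1)[of e h] by auto
  then show ?case
    using Cons.IH[of "h + rise e"] Cons.prems by (simp add: rise_def)
qed simp

lemma word_inj:
  assumes "awalk u p v" "normal p" "awalk u q v" "normal q"
    and "word h p = word h q" "height p = height q"
  shows "p = q"
  using assms
proof (induction p arbitrary: u q h)
  case Nil
  then have "height q = int (length q)"
    by (intro word_Nil_height[of _ h]) auto
  then show ?case
    using Nil by simp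
next
  case (Cons e p)
  have e: "e \<in> arcs Q" "tail Q e = u" and p: "awalk (head Q e) p v"
    using Cons.prems(1) by (auto simp: awalk_Cons_iff)
  have "q \<noteq> []"
  proof
    assume "q = []"
    then have "height (e # p) = int (length (e # p))"
      using Cons.prems \<open>q = []\<close> by (intro word_Nil_height[of _ h]) (simp_all add: awalk_def)
    then show False
      using \<open>q = []\<close> Cons.prems(6) by simp
  qed
  then obtain e' q' where q: "q = e' # q'"
    by (cases q) auto
  have e': "e' \<in> arcs Q" "tail Q e' = u" "awalk (head Q e') q' v"
    using Cons.prems(3) q by (auto simp: awalk_Cons_iff)
  have "e = e'"
  proof (cases "word h (e # p) = []")
    case True
    then have "chosen e" "chosen e'"
      using Cons.prems(5) emits_letters(1)[of e h] emits_letters(1)[of e' h] e e' q by auto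
    then show ?thesis
      using e e' chosen_iff by metis
  next
    case False
    then show ?thesis
      using hd_determined[OF Cons.prems(1-5)] q by simp
  qed
  then show ?case
    using Cons.IH[OF p _ _ _ , of q' "h + rise e"] Cons.prems e' q normal_ConsD by auto
qed

lemma val_inj:
  assumes "awalk u p v" "normal p" "awalk u q v" "normal q" "val p = val q"
  shows "p = q"
  using word_inj[OF assms(1-4), of 0] assms(5) by (simp add: val_def)

section \<open>The value of the leading term of a relation\<close>

lemma val_back_and_forth:
  assumes "e \<in> arcs Q"
  shows "val [e, bar e] = (0, letters 0 e @ letters (rise e) (bar e))"
  using chosen_bar[of e] by (auto simp: val_def rise_def)

lemma val_chosen:
  assumes "v \<in> verts Q"
  shows "val [c v, bar (c v)] = (0, letters 1 (bar (c v)))"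
  using assms by (simp add: val_back_and_forth) (simp add: letters_def rise_def)

lemma val_bar_chosen:
  assumes "v \<in> verts Q"
  shows "val [bar (c v), c v] = (0, letters 0 (bar (c v)))"
  using assms val_back_and_forth[of "bar (c v)"] by simp (simp add: letters_def)

lemma val_free:
  assumes "e \<in> free_arcs"
  shows "val [e, bar e] = (0, [(rank e, 0), (rank (bar e), 0)])"
  using assms by (auto simp: free_arcs_def val_back_and_forth letters_def rise_def)

lemma letters_bar_chosen:
  assumes "v \<in> verts Q"
  shows "letters h (bar (c v)) =
    (if cyclic v then [(0, 0), (0, 0), (0, 0)]
     else case top_feeder v of (f, k) \<Rightarrow>
       [(rank f, h - 1 - int k), (rank (bar f), h - 1 - int k)])"
  using assms chosen_bar[of "c v"] by (simp add: letters_def)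

lemma out_arc_cases:
  assumes "e \<in> arcs Q" "e \<noteq> c (tail Q e)"
  obtains "e \<in> free_arcs" | w where "w \<in> verts Q" "e = bar (c w)" "step w = tail Q e"
proof (cases "chosen (bar e)")
  case False
  then show ?thesis
    using that(1) assms chosen_iff by (simp add: free_arcs_def)
next
  case True
  then obtain w where w: "w \<in> verts Q" "bar e = c w"
    unfolding chosen_def by auto
  then show ?thesis
    using that(2)[of w] by (metis bar_bar head_bar step_def)
qed

lemma list2_less: "x < y \<Longrightarrow> [x, x'] < [y, y']" for x y :: "'l::linorder"
  by (simp add: list_less_def Cons_lenlex_iff)

lemma list23_less: "[x, x'] < [y, y', y'']" for x y :: "'l::linorder"
  by (simp add: list_less_def Cons_lenlex_iff)

text \<open>
  The same arrow cannot feed an acyclic vertex from two different distances, so feeders of equal rank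
  contribute equal letters.
\<close>

lemma feeder_letters_le:
  assumes "v \<in> verts Q" "\<not> cyclic v" "top_feeder v = (f, k)" "(f', k') \<in> feeders v"
  shows "[(rank f', - int k'), (rank (bar f'), - int k')] \<le> [(rank f, - int k), (rank (bar f), - int k)]"
proof -
  have f: "(f, k) \<in> feeders v" and le: "rank f' \<le> rank f"
    using top_feeder[OF assms(1,2)] assms(3,4) by auto
  show ?thesis
  proof (cases "rank f' = rank f")
    case True
    moreover have "f \<in> arcs Q" "f' \<in> arcs Q"
      using f assms(4) by (auto simp: feeders_def free_arcs_def)
    ultimately have "f' = f"
      using rank_inj by (auto dest: inj_onD)
    then show ?thesis
      using feeder_depth_unique f assms(2,4) by fastforce
  next
    case False
    then have "(rank f', - int k') < (rank f, - int k)"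
      using le by (simp add: less_prod_def)
    then show ?thesis
      by (intro less_imp_le list2_less)
  qed
qed

text \<open>
  If \<open>e\<close> is free, then it is a feeder of \<open>v\<close>. Otherwise \<open>e\<close> is the reverse of a chosen arrow \<open>c w\<close> that
  ends in \<open>v\<close>, and the top feeder of \<open>w\<close> also feeds \<open>v\<close>.
\<close>

lemma val_relation_le:
  assumes v: "v \<in> verts Q" and e: "e \<in> arcs Q" "tail Q e = v" "e \<noteq> c v"
  shows "val [e, bar e] \<le> val [c v, bar (c v)]"
proof -
  have cycle: ?thesis if "cyclic v" "val [e, bar e] = (0, [x, y])" for x y
    using that v list23_less[of x y "(0, 0)" "(0, 0)" "(0, 0)"]
    by (simp add: val_chosen letters_bar_chosen less_eq_prod_def)
  have feeder: ?thesis if "\<not> cyclic v" "(f', k') \<in> feeders v"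
    "val [e, bar e] = (0, [(rank f', - int k'), (rank (bar f'), - int k')])" for f' k'
    using that v feeder_letters_le[OF v that(1) _ that(2)]
    by (simp add: val_chosen letters_bar_chosen less_eq_prod_def split: prod.split)
  from e have "e \<noteq> c (tail Q e)"
    by simp
  with e(1) show ?thesis
  proof (cases rule: out_arc_cases)
    case 1
    then have "(e, 0) \<in> feeders v"
      using e(2) by (simp add: feeders_def)
    then show ?thesis
      using cycle feeder val_free[OF 1] by (cases "cyclic v") auto
  next
    case (2 w)
    then have bar_e: "bar e = c w"
      by simp
    have val_e: "val [e, bar e] = (0, letters 0 (bar (c w)))"
      using val_bar_chosen[OF 2(1)] 2(2) by simp
    show ?thesis
    proof (cases "cyclic w")
      case True
      then have "cyclic v"
        using 2(3) e(2) cyclic_step by metis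
      then show ?thesis
        using True v val_e 2(1) by (simp add: val_chosen letters_bar_chosen)
    next
      case False
      obtain f' k' where f': "top_feeder w = (f', k')"
        by fastforce
      then have "(f', Suc k') \<in> feeders v"
        using feeders_step top_feeder(1)[OF 2(1) False] 2(3) e(2) by metis
      moreover have "val [e, bar e]
          = (0, [(rank f', - int (Suc k')), (rank (bar f'), - int (Suc k'))])"
        using val_e letters_bar_chosen[OF 2(1), of 0] False f' by simp
      ultimately show ?thesis
        using cycle feeder by (cases "cyclic v") blast+
    qed
  qed
qed

text \<open>
  The value is attained by the first step from \<open>v\<close> back towards its top feeder, or back on its cycle.
\<close>

lemma val_relation_attained:
  assumes v: "v \<in> verts Q"
  shows "\<exists>e\<in>arcs Q. tail Q e = v \<and> e \<noteq> c v \<and> val [e, bar e] = val [c v, bar (c v)]"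
proof -
  have step_arc: ?thesis
    if w: "w \<in> verts Q" "step w = v" "letters 0 (bar (c w)) = letters 1 (bar (c v))" for w
  proof (intro bexI[of _ "bar (c w)"] conjI)
    show "tail Q (bar (c w)) = v"
      using w by (simp add: step_def)
    show "bar (c w) \<noteq> c v"
      using c_neq_bar[OF w(1) v] by metis
    show "val [bar (c w), bar (bar (c w))] = val [c v, bar (c v)]"
      using w v by (simp add: val_chosen val_bar_chosen)
  qed (use w in simp)
  show ?thesis
  proof (cases "cyclic v")
    case True
    then obtain w n where w: "cyclic w" "step w = v" "w = (step ^^ n) v"
      using cyclic_pred by blast
    then have "w \<in> verts Q"
      using v by simp
    then show ?thesis
      using step_arc[of w] w True v by (simp add: letters_bar_chosen)
  next
    case False
    obtain f k where f: "top_feeder v = (f, k)"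
      by fastforce
    then have fk: "(f, k) \<in> feeders v"
      using top_feeder(1)[OF v False] by simp
    then have free: "f \<in> free_arcs" and f_arc: "f \<in> arcs Q"
      by (auto simp: feeders_def free_arcs_def)
    show ?thesis
    proof (cases k)
      case 0
      then have "tail Q f = v"
        using fk by (simp add: feeders_def)
      moreover from this have "f \<noteq> c v"
        using free chosen_iff[OF f_arc] by (simp add: free_arcs_def)
      moreover have "val [f, bar f] = val [c v, bar (c v)]"
        using 0 f False v val_free[OF free] by (simp add: val_chosen letters_bar_chosen)
      ultimately show ?thesis
        using f_arc by blast
    next
      case (Suc k')
      define w where "w = (step ^^ k') (tail Q f)"
      have w: "w \<in> verts Q" "step w = v" "(f, k') \<in> feeders w"
        using fk f_arc Suc by (simp_all add: w_def feeders_def)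
      have acyclic: "\<not> cyclic w"
        using w(2) False cyclic_step by metis
      obtain g l where g: "top_feeder w = (g, l)"
        by fastforce
      then have gl: "(g, l) \<in> feeders w"
        using top_feeder(1)[OF w(1) acyclic] by simp
      have "rank f \<le> rank g"
        using top_feeder(2)[OF w(1) acyclic w(3)] g by simp
      moreover have "rank g \<le> rank f"
        using top_feeder(2)[OF v False] feeders_step[OF gl] w(2) f by fastforce
      moreover have "g \<in> arcs Q"
        using gl by (simp add: feeders_def free_arcs_def)
      ultimately have "g = f"
        using f_arc rank_inj by (auto dest: inj_onD)
      moreover from this have "l = k'"
        using feeder_depth_unique[OF _ w(3) acyclic] gl by simp
      ultimately show ?thesis
        using step_arc[OF w(1,2)] f g w(1) v acyclic False Suc by (simp add: letters_bar_chosen)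
    qed
  qed
qed

end

section \<open>Normal forms\<close>

locale weighted_quiver = oriented_quiver +
  fixes weight :: "'b \<Rightarrow> 'k::field"
  assumes weight_nonzero: "e \<in> arcs Q \<Longrightarrow> weight e \<noteq> 0"
begin

definition extend :: "'b \<Rightarrow> (('a, 'b) qpath \<Rightarrow>\<^sub>0 'k) \<Rightarrow> (('a, 'b) qpath \<Rightarrow>\<^sub>0 'k)" where
  "extend e = lin_ext (\<lambda>(u, p, x). Poly_Mapping.single (tail Q e, e # p, x) 1)"

text \<open>
  The normal form of \<open>e p\<close> for a normal path \<open>p\<close> that ends in \<open>x\<close>. Rewriting \<open>e (bar e) p\<close> for a chosen
  \<open>e\<close> leaves terms \<open>f (bar f) p\<close> with \<open>f\<close> not chosen. Here \<open>(bar f) p\<close> has to be reduced again, but as a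
  shorter problem, and putting \<open>f\<close> in front of the result creates no new factor to be rewritten.
\<close>

primrec reduct :: "'b list \<Rightarrow> 'b \<Rightarrow> 'a \<Rightarrow> (('a, 'b) qpath \<Rightarrow>\<^sub>0 'k)" where
  "reduct [] e x = Poly_Mapping.single (tail Q e, [e], x) 1"
| "reduct (e' # p) e x =
    (if chosen e \<and> e' = bar e
     then - (\<Sum>f\<in>out_arcs Q (tail Q e) - {e}. pm_scale (weight f / weight e) (extend f (reduct p (bar f) x)))
     else Poly_Mapping.single (tail Q e, e # e' # p, x) 1)"

definition act :: "'b \<Rightarrow> (('a, 'b) qpath \<Rightarrow>\<^sub>0 'k) \<Rightarrow> (('a, 'b) qpath \<Rightarrow>\<^sub>0 'k)" where
  "act e = lin_ext (\<lambda>(u, p, x). reduct p e x)"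

definition acts :: "'b list \<Rightarrow> (('a, 'b) qpath \<Rightarrow>\<^sub>0 'k) \<Rightarrow> (('a, 'b) qpath \<Rightarrow>\<^sub>0 'k)" where
  "acts p = foldr act p"

definition normal_form :: "(('a, 'b) qpath \<Rightarrow>\<^sub>0 'k) \<Rightarrow> (('a, 'b) qpath \<Rightarrow>\<^sub>0 'k)" where
  "normal_form = lin_ext (\<lambda>(u, p, x). acts p (Poly_Mapping.single (x, [], x) 1))"

definition normal_paths :: "'a \<Rightarrow> 'a \<Rightarrow> ('a, 'b) qpath set" where
  "normal_paths u x = {(u, p, x) | p. awalk u p x \<and> normal p}"

abbreviation path_val :: "('a, 'b) qpath \<Rightarrow> int \<times> (nat \<times> int) list" where
  "path_val P \<equiv> val (fst (snd P))"

lemma pm_linear_extend: "pm_linear (extend e)"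
  unfolding extend_def by (rule pm_linear_lin_ext)

lemma pm_linear_act: "pm_linear (act e)"
  unfolding act_def by (rule pm_linear_lin_ext)

lemma pm_linear_acts: "pm_linear (acts p)"
  unfolding acts_def by (induction p)
    (auto simp: comp_def id_def pm_linear_id intro: pm_linear_compose pm_linear_act)

lemma acts_simps [simp]:
  "acts [] f = f" "acts (e # p) f = act e (acts p f)" "acts (p @ q) f = acts p (acts q f)"
  by (simp_all add: acts_def)

lemma pm_linear_normal_form: "pm_linear normal_form"
  unfolding normal_form_def by (rule pm_linear_lin_ext)

lemma extend_single [simp]:
  "extend e (Poly_Mapping.single (u, p, x) d) = Poly_Mapping.single (tail Q e, e # p, x) d"
  by (simp add: extend_def)

lemma act_single: "act e (Poly_Mapping.single (u, p, x) 1) = reduct p e x"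
  by (simp add: act_def)

lemma normal_form_single:
  "normal_form (Poly_Mapping.single (u, p, x) 1) = acts p (Poly_Mapping.single (x, [], x) 1)"
  by (simp add: normal_form_def)

lemma reduct_not_chosen:
  "\<not> chosen e \<Longrightarrow> reduct p e x = Poly_Mapping.single (tail Q e, e # p, x) 1"
  by (cases p) simp_all

lemma act_not_chosen: "\<not> chosen e \<Longrightarrow> act e = extend e"
  by (simp add: act_def extend_def reduct_not_chosen)

lemma keys_extend: "Poly_Mapping.keys (extend e f) \<subseteq> (\<lambda>(u, p, x). (tail Q e, e # p, x)) ` Poly_Mapping.keys f"
  unfolding extend_def by (rule order_trans[OF keys_lin_ext]) (force split: if_splits)

lemma in_keys_extendI:
  assumes "(u, p, x) \<in> Poly_Mapping.keys f" "\<And>P. P \<in> Poly_Mapping.keys f \<Longrightarrow> fst P = u"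
  shows "(tail Q e, e # p, x) \<in> Poly_Mapping.keys (extend e f)"
  unfolding extend_def using assms(2)
  by (intro in_keys_lin_extI[OF assms(1)]) fastforce+

lemma reduct_start: "P \<in> Poly_Mapping.keys (reduct p e x) \<Longrightarrow> fst P = tail Q e"
proof (cases p)
  case (Cons e' q)
  assume P: "P \<in> Poly_Mapping.keys (reduct p e x)"
  show ?thesis
  proof (cases "chosen e \<and> e' = bar e")
    case True
    let ?F = "\<lambda>f. pm_scale (weight f / weight e) (extend f (reduct q (bar f) x))"
    have "P \<in> Poly_Mapping.keys (\<Sum>f\<in>out_arcs Q (tail Q e) - {e}. ?F f)"
      using P True Cons by simp
    then obtain f where f: "f \<in> out_arcs Q (tail Q e) - {e}" "P \<in> Poly_Mapping.keys (?F f)"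
      using Poly_Mapping.keys_sum[of ?F "out_arcs Q (tail Q e) - {e}"] by blast
    have "P \<in> Poly_Mapping.keys (extend f (reduct q (bar f) x))"
      by (rule subsetD[OF keys_pm_scale f(2)])
    then show ?thesis
      using subsetD[OF keys_extend] f(1) by fastforce
  next
    case False
    then show ?thesis
      using P Cons by (auto split: if_splits)
  qed
qed auto

section \<open>The relation acts as zero\<close>

text \<open>
  This is where the absence of overlaps is used: as \<open>bar (c v)\<close> is not chosen, the product of \<open>bar (c v)\<close> with a
  path is not rewritten, so that \<open>c v\<close> acts on it by the rewriting rule, which is the relation at \<open>v\<close>
  solved for its term \<open>c v (bar (c v))\<close>.
\<close>

lemma act_relation:
  assumes v: "v \<in> verts Q"
  shows "(\<Sum>e\<in>out_arcs Q v. pm_scale (weight e) (act e (act (bar e) f))) = 0"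
proof (rule pm_linear_eqI[of "\<lambda>f. \<Sum>e\<in>out_arcs Q v. pm_scale (weight e) (act e (act (bar e) f))" "\<lambda>f. 0"])
  show "pm_linear (\<lambda>f. \<Sum>e\<in>out_arcs Q v. pm_scale (weight e) (act e (act (bar e) f)))"
    by (intro pm_linear_sum_fun pm_linear_scaled pm_linear_compose[OF pm_linear_act pm_linear_act])
  show "pm_linear (\<lambda>f. 0)"
    by (rule pm_linear_const_zero)
  fix P :: "('a, 'b) qpath"
  obtain u p x where P: "P = (u, p, x)"
    by (cases P)
  define g where "g f = extend f (reduct p (bar f) x)" for f
  let ?t = "\<lambda>e. pm_scale (weight e) (act e (act (bar e) (Poly_Mapping.single P 1)))"
  let ?A = "out_arcs Q v - {c v}"
  have cv: "c v \<in> out_arcs Q v" "weight (c v) \<noteq> 0"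
    using v weight_nonzero by simp_all
  have other: "?t e = pm_scale (weight e) (g e)" if "e \<in> ?A" for e
  proof -
    have "\<not> chosen e"
      using that chosen_iff[of e] by auto
    then show ?thesis
      by (simp add: P act_single act_not_chosen g_def)
  qed
  have "act (bar (c v)) (Poly_Mapping.single P 1)
      = Poly_Mapping.single (tail Q (bar (c v)), bar (c v) # p, x) 1"
    using chosen_bar[of "c v"] v by (simp add: P act_single reduct_not_chosen)
  then have "act (c v) (act (bar (c v)) (Poly_Mapping.single P 1)) = reduct (bar (c v) # p) (c v) x"
    by (simp only: act_single)
  also have "\<dots> = - (\<Sum>f\<in>?A. pm_scale (weight f / weight (c v)) (g f))"
    using v by (simp add: g_def)
  finally have "?t (c v) = - (\<Sum>f\<in>?A. pm_scale (weight f) (g f))"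
    using cv(2) by (simp add: pm.scale_sum_right)
  moreover have "(\<Sum>e\<in>?A. ?t e) = (\<Sum>f\<in>?A. pm_scale (weight f) (g f))"
    by (rule sum.cong[OF refl other])
  ultimately have "?t (c v) + (\<Sum>e\<in>?A. ?t e) = 0"
    by simp
  then show "(\<Sum>e\<in>out_arcs Q v. ?t e) = 0"
    using sum.remove[of "out_arcs Q v" "c v" ?t] cv(1) finite_out_arcs by simp
qed

section \<open>Leading terms\<close>

lemma normal_pathsD:
  "P \<in> normal_paths u x \<Longrightarrow> fst P = u"
  "(u', p, x') \<in> normal_paths u x \<Longrightarrow> u' = u \<and> x' = x \<and> awalk u p x \<and> normal p"
  by (auto simp: normal_paths_def)

lemma normal_paths_qpaths: "normal_paths u x \<subseteq> qpaths Q"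
  by (auto simp: normal_paths_def qpaths_def)

text \<open>
  \<open>f\<close> is a combination of normal paths from \<open>u\<close> to \<open>x\<close> in which the maximal value is \<open>m\<close>. By \<open>val_inj\<close>
  there is only one path of this value.
\<close>

definition leads :: "(('a, 'b) qpath \<Rightarrow>\<^sub>0 'k) \<Rightarrow> 'a \<Rightarrow> 'a \<Rightarrow> int \<times> (nat \<times> int) list \<Rightarrow> bool" where
  "leads f u x m \<longleftrightarrow> Poly_Mapping.keys f \<subseteq> normal_paths u x \<and>
    (\<forall>P\<in>Poly_Mapping.keys f. path_val P \<le> m) \<and> (\<exists>P\<in>Poly_Mapping.keys f. path_val P = m)"

lemma val_Cons_le: "val p \<le> val q \<Longrightarrow> set p \<subseteq> arcs Q \<Longrightarrow> set q \<subseteq> arcs Q \<Longrightarrow> val (e # p) \<le> val (e # q)"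
  using val_mono[of p q "[e]" "[]"] by simp

lemma val_Cons_less: "val p < val q \<Longrightarrow> set p \<subseteq> arcs Q \<Longrightarrow> set q \<subseteq> arcs Q \<Longrightarrow> val (e # p) < val (e # q)"
  using val_mono_strict[of p q "[e]" "[]"] by simp

lemma val_Cons_cong: "val p = val q \<Longrightarrow> set p \<subseteq> arcs Q \<Longrightarrow> set q \<subseteq> arcs Q \<Longrightarrow> val (e # p) = val (e # q)"
  using val_cong[of p q "[e]" "[]"] by simp

lemma leads_single: "awalk u p x \<Longrightarrow> normal p \<Longrightarrow> leads (Poly_Mapping.single (u, p, x) 1) u x (val p)"
  by (simp add: leads_def normal_paths_def)

text \<open>
  In a rewriting step, the terms for different \<open>f\<close> start with different arrows and cannot cancel; by
  \<open>val_relation_attained\<close> one of them has the value of the path rewritten.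
\<close>

lemma leads_reduct:
  assumes "e \<in> arcs Q" "awalk (head Q e) p x" "normal p"
  shows "leads (reduct p e x) (tail Q e) x (val (e # p))"
  using assms
proof (induction p arbitrary: e)
  case Nil
  then show ?case
    using leads_single[of "tail Q e" "[e]" x] head_in_verts[of e] by (auto simp: awalk_simps)
next
  case (Cons e' p)
  show ?case
  proof (cases "chosen e \<and> e' = bar e")
    case False
    then show ?thesis
      using leads_single[of "tail Q e" "e # e' # p" x] Cons.prems by (auto simp: awalk_Cons_iff)
  next
    case True
    define v where "v = tail Q e"
    define A where "A = out_arcs Q v - {e}"
    define F where "F f = pm_scale (weight f / weight e) (extend f (reduct p (bar f) x))" for f
    have v: "v \<in> verts Q" and e: "e = c v"
      using True Cons.prems(1) chosen_iff by (simp_all add: v_def)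
    have finA: "finite A"
      by (simp add: A_def finite_out_arcs)
    have p: "awalk v p x" "normal p" "set p \<subseteq> arcs Q"
      using Cons.prems True normal_ConsD by (auto simp: awalk_Cons_iff v_def)
    have f: "f \<in> arcs Q" "tail Q f = v" "f \<noteq> c v" "\<not> chosen f" if "f \<in> A" for f
      using that e chosen_iff[of f] by (auto simp: A_def)
    have IH: "leads (reduct p (bar f) x) (head Q f) x (val (bar f # p))" if "f \<in> A" for f
      using Cons.IH[of "bar f"] f[OF that] p by simp
    have keys_F: "\<exists>q. P = (v, f # q, x) \<and> (head Q f, q, x) \<in> Poly_Mapping.keys (reduct p (bar f) x)"
      if "f \<in> A" "P \<in> Poly_Mapping.keys (F f)" for f P
    proof -
      have "P \<in> Poly_Mapping.keys (extend f (reduct p (bar f) x))"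
        using that(2) unfolding F_def by (rule subsetD[OF keys_pm_scale])
      then obtain u q x' where "P = (tail Q f, f # q, x')" "(u, q, x') \<in> Poly_Mapping.keys (reduct p (bar f) x)"
        using keys_extend by fast
      then show ?thesis
        using IH[OF that(1)] f(2)[OF that(1)] unfolding leads_def by (auto dest!: subsetD normal_pathsD(2))
    qed
    have arcs_q: "set q \<subseteq> arcs Q" "awalk (head Q f) q x" "normal q"
      if "f \<in> A" "(head Q f, q, x) \<in> Poly_Mapping.keys (reduct p (bar f) x)" for f q
      using IH[OF that(1)] that(2) unfolding leads_def by (auto dest!: subsetD normal_pathsD(2))
    have eq: "reduct (e' # p) e x = - (\<Sum>f\<in>A. F f)"
      using True by (simp add: A_def F_def v_def)
    have val_f: "val (f # bar f # p) \<le> val (e # e' # p)" if "f \<in> A" for f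
      using val_mono[OF val_relation_le[OF v f(1-3)[OF that]], of "[]" p] f[OF that] v True e by simp
    have keys_sum: "\<exists>f\<in>A. P \<in> Poly_Mapping.keys (F f)" if "P \<in> Poly_Mapping.keys (reduct (e' # p) e x)" for P
      using that Poly_Mapping.keys_sum[of F A] unfolding eq by auto
    have normal: "Poly_Mapping.keys (reduct (e' # p) e x) \<subseteq> normal_paths v x"
    proof
      fix P assume "P \<in> Poly_Mapping.keys (reduct (e' # p) e x)"
      then obtain f where fA: "f \<in> A" and "P \<in> Poly_Mapping.keys (F f)"
        using keys_sum by blast
      then obtain q where "P = (v, f # q, x)" "(head Q f, q, x) \<in> Poly_Mapping.keys (reduct p (bar f) x)"
        using keys_F by blast
      then show "P \<in> normal_paths v x"
        using arcs_q[OF fA] f[OF fA] by (simp add: normal_paths_def awalk_Cons_iff normal_Cons)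
    qed
    moreover have "path_val P \<le> val (e # e' # p)" if "P \<in> Poly_Mapping.keys (reduct (e' # p) e x)" for P
    proof -
      obtain f where fA: "f \<in> A" and "P \<in> Poly_Mapping.keys (F f)"
        using keys_sum \<open>P \<in> _\<close> by blast
      then obtain q where P: "P = (v, f # q, x)" and q: "(head Q f, q, x) \<in> Poly_Mapping.keys (reduct p (bar f) x)"
        using keys_F by blast
      have "val q \<le> val (bar f # p)"
        using IH[OF fA] q unfolding leads_def by auto
      then have "val (f # q) \<le> val (f # bar f # p)"
        using val_Cons_le arcs_q(1)[OF fA q] f[OF fA] p(3) by simp
      then show ?thesis
        using val_f[OF fA] P by simp
    qed
    moreover have "\<exists>P\<in>Poly_Mapping.keys (reduct (e' # p) e x). path_val P = val (e # e' # p)"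
    proof -
      obtain f where fv: "f \<in> arcs Q" "tail Q f = v" "f \<noteq> c v"
        and top: "val [f, bar f] = val [c v, bar (c v)]"
        using val_relation_attained[OF v] by blast
      then have fA: "f \<in> A"
        using e by (simp add: A_def)
      obtain q where q: "(head Q f, q, x) \<in> Poly_Mapping.keys (reduct p (bar f) x)"
        and val_q: "val q = val (bar f # p)"
        using IH[OF fA] unfolding leads_def by (auto dest!: subsetD normal_pathsD(2))
      have "(tail Q f, f # q, x) \<in> Poly_Mapping.keys (extend f (reduct p (bar f) x))"
        using reduct_start by (intro in_keys_extendI[OF q]) fastforce
      then have "(v, f # q, x) \<in> Poly_Mapping.keys (F f)"
        using f[OF fA] weight_nonzero Cons.prems(1) by (simp add: F_def keys_pm_scale_eq)
      then have "(v, f # q, x) \<in> Poly_Mapping.keys (\<Sum>f\<in>A. F f)"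
        by (rule in_keys_sumI[OF finA fA]) (auto dest: keys_F)
      moreover have "val (f # q) = val (e # e' # p)"
        using val_Cons_cong[OF val_q, of f] val_cong[OF top, of "[]" p] arcs_q(1)[OF fA q] fv v p(3) True e
        by simp
      ultimately show ?thesis
        unfolding eq by force
    qed
    ultimately show ?thesis
      unfolding leads_def v_def by blast
  qed
qed

text \<open>
  The leading path of \<open>f\<close> is the only one whose image reaches the value of \<open>e p\<close>: all others are
  smaller, and \<open>e\<close> preserves the strict inequality.
\<close>

lemma leads_act:
  assumes "e \<in> arcs Q" "leads f (head Q e) x m" "m = val p" "set p \<subseteq> arcs Q"
  shows "leads (act e f) (tail Q e) x (val (e # p))"
proof -
  have key: "\<exists>q. P = (head Q e, q, x) \<and> awalk (head Q e) q x \<and> normal q \<and> set q \<subseteq> arcs Q \<and> val q \<le> val p"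
    if "P \<in> Poly_Mapping.keys f" for P
    using assms(2,3) that unfolding leads_def normal_paths_def by fastforce
  have red: "leads (reduct q e x) (tail Q e) x (val (e # q))" if "awalk (head Q e) q x" "normal q" for q
    using leads_reduct assms(1) that .
  have keys_act: "\<exists>q. (head Q e, q, x) \<in> Poly_Mapping.keys f \<and> P \<in> Poly_Mapping.keys (reduct q e x)"
    if "P \<in> Poly_Mapping.keys (act e f)" for P
  proof -
    have "P \<in> (\<Union>R\<in>Poly_Mapping.keys f. Poly_Mapping.keys ((\<lambda>(u, p, x). reduct p e x) R))"
      using that unfolding act_def by (rule subsetD[OF keys_lin_ext])
    then obtain R where "R \<in> Poly_Mapping.keys f" "P \<in> Poly_Mapping.keys ((\<lambda>(u, p, x). reduct p e x) R)"
      by blast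
    then show ?thesis
      using key[of R] by auto
  qed
  have "Poly_Mapping.keys (act e f) \<subseteq> normal_paths (tail Q e) x"
    using keys_act key red unfolding leads_def by blast
  moreover have "path_val P \<le> val (e # p)" if "P \<in> Poly_Mapping.keys (act e f)" for P
  proof -
    obtain q where q: "(head Q e, q, x) \<in> Poly_Mapping.keys f" "P \<in> Poly_Mapping.keys (reduct q e x)"
      using keys_act \<open>P \<in> _\<close> by blast
    then have "path_val P \<le> val (e # q)"
      using red key[OF q(1)] unfolding leads_def by auto
    also have "\<dots> \<le> val (e # p)"
      using key[OF q(1)] assms(4) val_Cons_le by auto
    finally show ?thesis .
  qed
  moreover have "\<exists>P\<in>Poly_Mapping.keys (act e f). path_val P = val (e # p)"
  proof -
    obtain R where R: "R \<in> Poly_Mapping.keys f" "path_val R = m"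
      using assms(2) unfolding leads_def by blast
    then obtain q where Rq: "R = (head Q e, q, x)" and q: "awalk (head Q e) q x" "normal q" "set q \<subseteq> arcs Q"
      using key by blast
    have val_q: "val q = val p"
      using R(2) Rq assms(3) by simp
    obtain P where P: "P \<in> Poly_Mapping.keys (reduct q e x)" "path_val P = val (e # q)"
      using red[OF q(1,2)] unfolding leads_def by blast
    have "P \<notin> Poly_Mapping.keys (reduct q' e x)"
      if q': "(head Q e, q', x) \<in> Poly_Mapping.keys f" "q' \<noteq> q" for q'
    proof
      assume "P \<in> Poly_Mapping.keys (reduct q' e x)"
      then have "val (e # q) \<le> val (e # q')"
        using red[of q'] key[OF q'(1)] P(2) unfolding leads_def by auto
      moreover have "val q' \<noteq> val q"
        using val_inj[of "head Q e" q' x q] q q' key[OF q'(1)] by auto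
      then have "val (e # q') < val (e # q)"
        using val_Cons_less[of q' q e] key[OF q'(1)] q(3) val_q by auto
      ultimately show False
        by simp
    qed
    then have "P \<in> Poly_Mapping.keys (act e f)"
      unfolding act_def using P(1) Rq key
      by (intro in_keys_lin_extI[OF R(1)]) fastforce+
    then show ?thesis
      using P(2) val_Cons_cong[OF val_q] q(3) assms(4) by auto
  qed
  ultimately show ?thesis
    unfolding leads_def by blast
qed

lemma leads_path:
  assumes "awalk u p x"
  shows "leads (acts p (Poly_Mapping.single (x, [], x) 1)) u x (val p)"
  using assms
proof (induction p arbitrary: u)
  case Nil
  then show ?case
    using leads_single[of u "[]" x] by (auto simp: awalk_Nil_iff)
next
  case (Cons e p)
  then show ?case
    using leads_act[of e "acts p (Poly_Mapping.single (x, [], x) 1)" x "val p" p]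
    by (auto simp: awalk_Cons_iff)
qed

lemma ex_leads:
  assumes "Poly_Mapping.keys f \<subseteq> normal_paths u x" "f \<noteq> 0"
  shows "\<exists>m. leads f u x m"
proof -
  let ?V = "path_val ` Poly_Mapping.keys f"
  have V: "finite ?V" "?V \<noteq> {}"
    using assms(2) by simp_all
  have "leads f u x (Max ?V)"
    unfolding leads_def
  proof (intro conjI ballI assms(1))
    fix P assume "P \<in> Poly_Mapping.keys f"
    then show "path_val P \<le> Max ?V"
      using Max_ge[OF V(1)] by blast
  next
    obtain P where "P \<in> Poly_Mapping.keys f" "Max ?V = path_val P"
      using Max_in[OF V] by (rule imageE)
    then show "\<exists>P\<in>Poly_Mapping.keys f. path_val P = Max ?V"
      by metis
  qed
  then show ?thesis ..
qed

text \<open>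
  The product of the two leading paths has a value that is strictly above those of all other products
  of terms, so its leading term is not cancelled.
\<close>

lemma normal_form_mult_nonzero:
  assumes f: "Poly_Mapping.keys f \<subseteq> normal_paths u v" "f \<noteq> 0"
    and g: "Poly_Mapping.keys g \<subseteq> normal_paths v x" "g \<noteq> 0"
  shows "normal_form (path_mult f g) \<noteq> 0"
proof -
  define H where "H P R = normal_form (path_prod P R 1)" for P R
  have H: "leads (H (u, p, v) (v, r, x)) u x (val (p @ r))" if "awalk u p v" "awalk v r x" for p r
    using leads_path[of u "p @ r" x] that by (simp add: H_def normal_form_single)
  have expand: "normal_form (path_mult f g) = lin_ext (\<lambda>P. lin_ext (\<lambda>R. H P R) g) f"
    by (simp add: pm_linear_comp_lin_ext[OF pm_linear_normal_form] H_def)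
  have lead_word: "\<exists>p. (u, p, v) \<in> Poly_Mapping.keys f \<and> (\<forall>P\<in>Poly_Mapping.keys f. path_val P \<le> val p)"
    if "leads f u v m" for f u v m
  proof -
    obtain P where P: "P \<in> Poly_Mapping.keys f" "path_val P = m"
      using \<open>leads f u v m\<close> unfolding leads_def by blast
    moreover from this obtain p where "P = (u, p, v)"
      using \<open>leads f u v m\<close> unfolding leads_def normal_paths_def by blast
    ultimately show ?thesis
      using \<open>leads f u v m\<close> unfolding leads_def by auto
  qed
  obtain m n where "leads f u v m" and "leads g v x n"
    using ex_leads f g by blast
  then obtain p r where p: "(u, p, v) \<in> Poly_Mapping.keys f"
      "\<And>P. P \<in> Poly_Mapping.keys f \<Longrightarrow> path_val P \<le> val p"
    and r: "(v, r, x) \<in> Poly_Mapping.keys g"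
      "\<And>R. R \<in> Poly_Mapping.keys g \<Longrightarrow> path_val R \<le> val r"
    using lead_word by metis
  have keys_f: "\<exists>p'. P = (u, p', v) \<and> awalk u p' v \<and> normal p' \<and> val p' \<le> val p \<and> (val p' = val p \<longrightarrow> p' = p)"
    if P: "P \<in> Poly_Mapping.keys f" for P
  proof -
    obtain p' where p': "P = (u, p', v)" "awalk u p' v" "normal p'"
      using subsetD[OF f(1) P] unfolding normal_paths_def by blast
    moreover have "awalk u p v" "normal p"
      using subsetD[OF f(1) p(1)] by (auto simp: normal_paths_def)
    ultimately show ?thesis
      using p(2)[OF P] val_inj by auto
  qed
  have keys_g: "\<exists>r'. R = (v, r', x) \<and> awalk v r' x \<and> normal r' \<and> val r' \<le> val r \<and> (val r' = val r \<longrightarrow> r' = r)"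
    if R: "R \<in> Poly_Mapping.keys g" for R
  proof -
    obtain r' where r': "R = (v, r', x)" "awalk v r' x" "normal r'"
      using subsetD[OF g(1) R] unfolding normal_paths_def by blast
    moreover have "awalk v r x" "normal r"
      using subsetD[OF g(1) r(1)] by (auto simp: normal_paths_def)
    ultimately show ?thesis
      using r(2)[OF R] val_inj by auto
  qed
  have pr: "awalk u p v" "awalk v r x"
    using keys_f[OF p(1)] keys_g[OF r(1)] by auto
  obtain P where P: "P \<in> Poly_Mapping.keys (H (u, p, v) (v, r, x))" "path_val P = val (p @ r)"
    using H[OF pr] unfolding leads_def by blast
  have unique: "p' = p \<and> r' = r"
    if *: "(u, p', v) \<in> Poly_Mapping.keys f" "(v, r', x) \<in> Poly_Mapping.keys g"
      "P \<in> Poly_Mapping.keys (H (u, p', v) (v, r', x))" for p' r'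
  proof -
    have p': "awalk u p' v" "val p' \<le> val p" "val p' = val p \<Longrightarrow> p' = p"
      and r': "awalk v r' x" "val r' \<le> val r" "val r' = val r \<Longrightarrow> r' = r"
      using keys_f[OF *(1)] keys_g[OF *(2)] by auto
    have sub: "set p \<subseteq> arcs Q" "set p' \<subseteq> arcs Q" "set r \<subseteq> arcs Q" "set r' \<subseteq> arcs Q"
      using pr p'(1) r'(1) by auto
    have ge: "val (p @ r) \<le> val (p' @ r')"
      using H[OF p'(1) r'(1)] *(3) P(2) unfolding leads_def by auto
    have le1: "val (p' @ r') \<le> val (p @ r')"
      using val_mono[OF p'(2), of "[]" r'] sub by simp
    have le2: "val (p @ r') \<le> val (p @ r)"
      using val_mono[OF r'(2), of p "[]"] sub by simp
    have "val p' = val p"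
    proof (rule ccontr)
      assume "val p' \<noteq> val p"
      then have "val (p' @ r') < val (p @ r')"
        using val_mono_strict[of p' p "[]" r'] p'(2) sub by simp
      then show False
        using ge le2 by simp
    qed
    moreover have "val r' = val r"
    proof (rule ccontr)
      assume "val r' \<noteq> val r"
      then have "val (p @ r') < val (p @ r)"
        using val_mono_strict[of r' r p "[]"] r'(2) sub by simp
      then show False
        using ge le1 by simp
    qed
    ultimately show ?thesis
      using p'(3) r'(3) by blast
  qed
  have inner: "P \<in> Poly_Mapping.keys (lin_ext (H (u, p, v)) g)"
    using unique[OF p(1)] keys_g
    by (intro in_keys_lin_extI[where F = "H (u, p, v)", OF r(1) P(1)]) blast
  have "P \<notin> Poly_Mapping.keys (lin_ext (H P') g)"
    if "P' \<in> Poly_Mapping.keys f" "P' \<noteq> (u, p, v)" for P'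
    using keys_lin_ext[of "H P'" g] unique keys_f[OF that(1)] keys_g that by blast
  then have "P \<in> Poly_Mapping.keys (normal_form (path_mult f g))"
    unfolding expand using inner by (intro in_keys_lin_extI[OF p(1)]) auto
  then show ?thesis
    by auto
qed

end

section \<open>The ideal of the relation\<close>

context weighted_quiver
begin

abbreviation \<A> :: "(('a, 'b) qpath \<Rightarrow>\<^sub>0 'k) ring" where
  "\<A> \<equiv> path_algebra TYPE('k) Q"

definition relation :: "('a, 'b) qpath \<Rightarrow>\<^sub>0 'k" where
  "relation = (\<Sum>e\<in>arcs Q. pm_scale (weight e) (Poly_Mapping.single (tail Q e, [e, bar e], tail Q e) 1))"

definition relation_ideal :: "(('a, 'b) qpath \<Rightarrow>\<^sub>0 'k) set" where
  "relation_ideal = Idl\<^bsub>\<A>\<^esub> {relation}"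

interpretation A: ring \<A>
  by (rule ring_path_algebra)

lemma back_and_forth_qpath: "e \<in> arcs Q \<Longrightarrow> (tail Q e, [e, bar e], tail Q e) \<in> qpaths Q"
  by (simp add: qpaths_def awalk_simps)

lemma relation_carrier: "relation \<in> carrier \<A>"
proof -
  let ?F = "\<lambda>e. pm_scale (weight e) (Poly_Mapping.single (tail Q e, [e, bar e], tail Q e) 1)"
  have "Poly_Mapping.keys (?F e) \<subseteq> qpaths Q" if "e \<in> arcs Q" for e
    using back_and_forth_qpath[OF that] by simp
  then have "(\<Union>e\<in>arcs Q. Poly_Mapping.keys (?F e)) \<subseteq> qpaths Q"
    by blast
  with Poly_Mapping.keys_sum[of ?F "arcs Q"] show ?thesis
    unfolding relation_def path_algebra_simps by blast
qed

lemma ideal_relation_ideal: "ideal relation_ideal \<A>"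
  unfolding relation_ideal_def by (rule A.genideal_ideal) (simp add: relation_carrier)

lemma relation_in_ideal: "relation \<in> relation_ideal"
  unfolding relation_ideal_def using A.genideal_self[of "{relation}"] relation_carrier by simp

lemma relation_ideal_carrier: "relation_ideal \<subseteq> carrier \<A>"
  using ideal_relation_ideal by (meson additive_subgroup.a_subset ideal.axioms(1))

definition start_at :: "'a \<Rightarrow> (('a, 'b) qpath \<Rightarrow>\<^sub>0 'k) \<Rightarrow> (('a, 'b) qpath \<Rightarrow>\<^sub>0 'k)" where
  "start_at v = lin_ext (\<lambda>P. if fst P = v then Poly_Mapping.single P 1 else 0)"

lemma pm_linear_start_at: "pm_linear (start_at v)"
  unfolding start_at_def by (rule pm_linear_lin_ext)

lemma start_at_eq:
  assumes "\<And>P. P \<in> Poly_Mapping.keys f \<Longrightarrow> fst P = w"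
  shows "start_at v f = (if w = v then f else 0)"
proof (cases "w = v")
  case True
  have "start_at v f = lin_ext (\<lambda>P. Poly_Mapping.single P 1) f"
    unfolding start_at_def by (rule lin_ext_cong) (simp add: assms True)
  then show ?thesis
    by (simp add: True lin_ext_singles)
next
  case False
  have "start_at v f = lin_ext (\<lambda>P. 0) f"
    unfolding start_at_def by (rule lin_ext_cong) (simp add: assms False)
  then show ?thesis
    by (simp add: False lin_ext_def)
qed

text \<open>
  Normal forms turn left multiplication by a path into the action of the path, so that they can be
  computed in the module defined by \<open>act\<close>. Paths that start elsewhere have to be removed first, because
  \<open>act e\<close> does not look at the starting point of its argument.
\<close>

lemma normal_form_path_mult:
  assumes "Poly_Mapping.keys g \<subseteq> qpaths Q"
  shows "normal_form (path_mult (Poly_Mapping.single (u, p, v) 1) g) = acts p (start_at v (normal_form g))"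
proof (rule pm_linear_eqI[of "\<lambda>g. normal_form (path_mult (Poly_Mapping.single (u, p, v) 1) g)"
      "\<lambda>g. acts p (start_at v (normal_form g))"])
  show "pm_linear (\<lambda>g. normal_form (path_mult (Poly_Mapping.single (u, p, v) 1) g))"
    by (rule pm_linear_compose[OF pm_linear_path_mult_right pm_linear_normal_form])
  show "pm_linear (\<lambda>g. acts p (start_at v (normal_form g)))"
    by (rule pm_linear_compose[OF pm_linear_compose[OF pm_linear_normal_form pm_linear_start_at]
          pm_linear_acts])
  fix R assume "R \<in> Poly_Mapping.keys g"
  moreover obtain w q x where R: "R = (w, q, x)"
    by (cases R)
  ultimately have "awalk w q x"
    using assms by (auto simp: qpaths_def)
  then have "leads (acts q (Poly_Mapping.single (x, [], x) 1)) w x (val q)"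
    by (rule leads_path)
  then have "fst P = w" if "P \<in> Poly_Mapping.keys (acts q (Poly_Mapping.single (x, [], x) 1))" for P
    using that unfolding leads_def by (auto dest: normal_pathsD(1))
  then have start: "start_at v (acts q (Poly_Mapping.single (x, [], x) 1))
      = (if w = v then acts q (Poly_Mapping.single (x, [], x) 1) else 0)"
    by (rule start_at_eq)
  have "normal_form (path_mult (Poly_Mapping.single (u, p, v) 1) (Poly_Mapping.single R 1))
      = (if w = v then acts (p @ q) (Poly_Mapping.single (x, [], x) 1) else 0)"
    unfolding R path_mult_single
    by (simp add: normal_form_single pm_linear_zero[OF pm_linear_normal_form])
  then show "normal_form (path_mult (Poly_Mapping.single (u, p, v) 1) (Poly_Mapping.single R 1))
      = acts p (start_at v (normal_form (Poly_Mapping.single R 1)))"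
    unfolding R normal_form_single start
    by (simp add: pm_linear_zero[OF pm_linear_acts])
qed

lemma normal_form_mult_zero:
  assumes "Poly_Mapping.keys g \<subseteq> qpaths Q" "normal_form g = 0"
  shows "normal_form (path_mult f g) = 0"
proof (rule pm_linear_eqI[of "\<lambda>f. normal_form (path_mult f g)" "\<lambda>f. 0"])
  fix P :: "('a, 'b) qpath"
  obtain u p v where P: "P = (u, p, v)"
    by (cases P)
  show "normal_form (path_mult (Poly_Mapping.single P 1) g) = 0"
    unfolding P normal_form_path_mult[OF assms(1)] assms(2)
    by (simp add: pm_linear_zero[OF pm_linear_start_at] pm_linear_zero[OF pm_linear_acts])
qed (rule pm_linear_compose[OF pm_linear_path_mult_left pm_linear_normal_form]
    pm_linear_const_zero)+

lemma normal_form_relation_mult: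
  assumes "Poly_Mapping.keys g \<subseteq> qpaths Q"
  shows "normal_form (path_mult relation g) = 0"
proof -
  let ?s = "\<lambda>e. Poly_Mapping.single (tail Q e, [e, bar e], tail Q e) 1"
  let ?h = "\<lambda>f. normal_form (path_mult f g)"
  let ?t = "\<lambda>e. pm_scale (weight e) (act e (act (bar e) (start_at (tail Q e) (normal_form g))))"
  have lin: "pm_linear ?h"
    by (rule pm_linear_compose[OF pm_linear_path_mult_left pm_linear_normal_form])
  have "?h relation = (\<Sum>e\<in>arcs Q. ?t e)"
    unfolding relation_def
    by (simp only: pm_linear_sum[OF lin] pm_linear_scale[OF lin] normal_form_path_mult[OF assms] acts_simps)
  also have "\<dots> = (\<Sum>v\<in>verts Q. \<Sum>e\<in>{e\<in>arcs Q. tail Q e = v}. ?t e)"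
    by (rule sum.group[symmetric]) auto
  also have "\<dots> = (\<Sum>v\<in>verts Q. \<Sum>e\<in>out_arcs Q v.
      pm_scale (weight e) (act e (act (bar e) (start_at v (normal_form g)))))"
    by (intro sum.cong) (auto simp: out_arcs_def)
  also have "\<dots> = 0"
    by (simp add: act_relation)
  finally show ?thesis .
qed

text \<open>
  The elements whose right multiples all have normal form zero are an ideal: under left multiplication
  this holds by \<open>normal_form_mult_zero\<close>. The relation belongs to it.
\<close>

lemma normal_form_ideal:
  assumes "f \<in> relation_ideal"
  shows "normal_form f = 0"
proof -
  \<comment> \<open>Right multiples are included in order to make this a two-sided ideal.\<close>
  define K where "K = {f \<in> carrier \<A>. \<forall>g\<in>carrier \<A>. normal_form (path_mult f g) = 0}"
  have "ideal K \<A>"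
  proof (rule idealI)
    show "ring \<A>"
      by (rule A.ring_axioms)
    show "subgroup K (add_monoid \<A>)"
    proof (rule group.subgroupI[OF A.a_group])
      show "K \<subseteq> carrier (add_monoid \<A>)"
        by (auto simp: K_def)
      show "K \<noteq> {}"
      proof -
        have "0 \<in> K"
          by (simp add: K_def path_algebra_simps pm_linear_zero[OF pm_linear_normal_form])
        then show ?thesis
          by blast
      qed
      fix f g assume "f \<in> K"
      then have "\<ominus>\<^bsub>\<A>\<^esub> f \<in> K"
        by (auto simp: K_def path_algebra_minus pm_linear_minus[OF pm_linear_path_mult_left]
            pm_linear_minus[OF pm_linear_normal_form])
          (simp add: path_algebra_simps)
      then show "inv\<^bsub>add_monoid \<A>\<^esub> f \<in> K"
        by (simp add: a_inv_def)
      assume "g \<in> K"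
      then show "f \<otimes>\<^bsub>add_monoid \<A>\<^esub> g \<in> K"
        using \<open>f \<in> K\<close> A.a_closed[of f g] unfolding K_def
        by (simp add: path_algebra_simps pm_linear_add[OF pm_linear_path_mult_left]
            pm_linear_add[OF pm_linear_normal_form])
    qed
    fix f x assume f: "f \<in> K" and x: "x \<in> carrier \<A>"
    have "normal_form (path_mult (path_mult x f) g) = 0" if "g \<in> carrier \<A>" for g
      unfolding path_mult_assoc
      by (rule normal_form_mult_zero)
        (use f that path_mult_closed in \<open>auto simp: K_def path_algebra_simps\<close>)
    then show "x \<otimes>\<^bsub>\<A>\<^esub> f \<in> K"
      using f x A.m_closed[of x f] by (simp add: K_def mult_path_algebra)
    show "f \<otimes>\<^bsub>\<A>\<^esub> x \<in> K"
      using f x A.m_closed[of f x] A.m_closed[of x]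
      by (simp add: K_def mult_path_algebra path_mult_assoc)
  qed
  moreover have "relation \<in> K"
    using relation_carrier normal_form_relation_mult by (simp add: K_def path_algebra_simps)
  ultimately have "f \<in> K"
    using assms A.genideal_minimal[of K "{relation}"] unfolding relation_ideal_def by blast
  then have "normal_form (f \<otimes>\<^bsub>\<A>\<^esub> \<one>\<^bsub>\<A>\<^esub>) = 0"
    using A.one_closed by (simp add: K_def mult_path_algebra)
  then show ?thesis
    using \<open>f \<in> K\<close> by (simp add: K_def)
qed

section \<open>Every element is congruent to its normal form\<close>

lemma ideal_zero: "0 \<in> relation_ideal"
  using additive_subgroup.zero_closed[OF ideal.axioms(1)[OF ideal_relation_ideal]]
  by (simp add: path_algebra_simps)

lemma ideal_add: "f \<in> relation_ideal \<Longrightarrow> g \<in> relation_ideal \<Longrightarrow> f + g \<in> relation_ideal"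
  using additive_subgroup.a_closed[OF ideal.axioms(1)[OF ideal_relation_ideal], of f g]
  by (simp add: path_algebra_simps)

lemma ideal_mult_left: "f \<in> relation_ideal \<Longrightarrow> x \<in> carrier \<A> \<Longrightarrow> path_mult x f \<in> relation_ideal"
  using ideal.I_l_closed[OF ideal_relation_ideal] by (simp add: mult_path_algebra)

lemma ideal_mult_right: "f \<in> relation_ideal \<Longrightarrow> x \<in> carrier \<A> \<Longrightarrow> path_mult f x \<in> relation_ideal"
  using ideal.I_r_closed[OF ideal_relation_ideal] by (simp add: mult_path_algebra)

lemma ideal_scale:
  assumes "f \<in> relation_ideal"
  shows "pm_scale d f \<in> relation_ideal"
proof -
  have f: "f \<in> carrier \<A>"
    using assms relation_ideal_carrier by blast
  have "pm_scale d \<one>\<^bsub>\<A>\<^esub> \<in> carrier \<A>"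
    using A.one_closed keys_pm_scale[of d "\<one>\<^bsub>\<A>\<^esub>"] by (auto simp: path_algebra_simps(1))
  then have "path_mult (pm_scale d \<one>\<^bsub>\<A>\<^esub>) f \<in> relation_ideal"
    by (rule ideal_mult_left[OF assms])
  also have "path_mult (pm_scale d \<one>\<^bsub>\<A>\<^esub>) f = pm_scale d (path_mult \<one>\<^bsub>\<A>\<^esub> f)"
    by (rule pm_linear_scale[OF pm_linear_path_mult_left])
  also have "path_mult \<one>\<^bsub>\<A>\<^esub> f = f"
    using A.l_one[OF f] by (simp add: mult_path_algebra)
  finally show ?thesis .
qed

lemma ideal_diff: "f \<in> relation_ideal \<Longrightarrow> g \<in> relation_ideal \<Longrightarrow> f - g \<in> relation_ideal"
  using ideal_add[of f "pm_scale (- 1) g"] ideal_scale[of g "- 1"] by simp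

lemma ideal_sum: "(\<And>i. i \<in> S \<Longrightarrow> f i \<in> relation_ideal) \<Longrightarrow> (\<Sum>i\<in>S. f i) \<in> relation_ideal"
  by (induction S rule: infinite_finite_induct) (simp_all add: ideal_zero ideal_add)

lemma ideal_lin_ext:
  "(\<And>x. x \<in> Poly_Mapping.keys f \<Longrightarrow> F x \<in> relation_ideal) \<Longrightarrow> lin_ext F f \<in> relation_ideal"
  unfolding lin_ext_def by (intro ideal_sum ideal_scale)

lemma trivial_path_carrier: "v \<in> verts Q \<Longrightarrow> trivial_path v \<in> carrier \<A>"
  by (simp add: path_algebra_simps trivial_path_def qpaths_def awalk_Nil_iff)

lemma extend_eq_mult:
  assumes "\<And>P. P \<in> Poly_Mapping.keys f \<Longrightarrow> fst P = head Q e"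
  shows "extend e f = path_mult (Poly_Mapping.single (tail Q e, [e], head Q e) 1) f"
proof (rule pm_linear_eqI[of "extend e" "\<lambda>f. path_mult (Poly_Mapping.single (tail Q e, [e], head Q e) 1) f"])
  fix P assume "P \<in> Poly_Mapping.keys f"
  then obtain p x where "P = (head Q e, p, x)"
    using assms by (metis prod.collapse)
  then show "extend e (Poly_Mapping.single P 1)
      = path_mult (Poly_Mapping.single (tail Q e, [e], head Q e) 1) (Poly_Mapping.single P 1)"
    by simp
qed (rule pm_linear_extend pm_linear_path_mult_right)+

lemma extend_ideal:
  assumes "f \<in> relation_ideal" "e \<in> arcs Q" "\<And>P. P \<in> Poly_Mapping.keys f \<Longrightarrow> fst P = head Q e"
  shows "extend e f \<in> relation_ideal"
proof -
  have "Poly_Mapping.single (tail Q e, [e], head Q e) 1 \<in> carrier \<A>"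
    using assms(2) by (simp add: path_algebra_simps qpaths_def awalk_simps)
  then have "path_mult (Poly_Mapping.single (tail Q e, [e], head Q e) 1) f \<in> relation_ideal"
    by (rule ideal_mult_left[OF assms(1)])
  then show ?thesis
    using extend_eq_mult[OF assms(3)] by simp
qed

text \<open>
  The relation is a sum over all vertices; multiplication by a trivial path extracts the part at one
  vertex.
\<close>

lemma vertex_relation_ideal:
  assumes "awalk v p x"
  shows "(\<Sum>e\<in>out_arcs Q v. pm_scale (weight e) (Poly_Mapping.single (v, e # bar e # p, x) 1))
    \<in> relation_ideal"
proof -
  let ?P = "Poly_Mapping.single (v, p, x) 1"
  let ?s = "\<lambda>e. Poly_Mapping.single (tail Q e, [e, bar e], tail Q e) 1"
  have v: "v \<in> verts Q"
    using assms by auto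
  have lin: "pm_linear (\<lambda>f. path_mult (path_mult (trivial_path v) f) ?P)"
    by (rule pm_linear_compose[OF pm_linear_path_mult_right pm_linear_path_mult_left])
  have "path_mult (path_mult (trivial_path v) relation) ?P
      = (\<Sum>e\<in>arcs Q. pm_scale (weight e) (path_mult (path_mult (trivial_path v) (?s e)) ?P))"
    unfolding relation_def by (simp only: pm_linear_sum[OF lin] pm_linear_scale[OF lin])
  also have "\<dots> = (\<Sum>e\<in>arcs Q. if tail Q e = v
      then pm_scale (weight e) (Poly_Mapping.single (v, e # bar e # p, x) 1) else 0)"
    by (intro sum.cong) (auto simp: trivial_path_mult_left simp del: lin_ext_single)
  also have "\<dots> = (\<Sum>e\<in>out_arcs Q v. pm_scale (weight e) (Poly_Mapping.single (v, e # bar e # p, x) 1))"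
    unfolding out_arcs_def by (rule sum.inter_filter[symmetric]) simp
  finally show ?thesis
    using ideal_mult_right[OF ideal_mult_left[OF relation_in_ideal trivial_path_carrier[OF v]], of ?P]
      assms by (simp add: path_algebra_simps qpaths_def)
qed

lemma reduct_congruent:
  assumes "e \<in> arcs Q" "awalk (head Q e) p x"
  shows "Poly_Mapping.single (tail Q e, e # p, x) 1 - reduct p e x \<in> relation_ideal"
  using assms
proof (induction p arbitrary: e)
  case (Cons e' p)
  show ?case
  proof (cases "chosen e \<and> e' = bar e")
    case True
    define v where "v = tail Q e"
    define A where "A = out_arcs Q v - {e}"
    let ?s = "\<lambda>f. Poly_Mapping.single (v, f # bar f # p, x) (1 :: 'k)"
    let ?w = "\<lambda>f. weight f / weight e"
    have p: "awalk v p x"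
      using Cons.prems True by (auto simp: awalk_Cons_iff v_def)
    have e: "e \<in> out_arcs Q v" "weight e \<noteq> 0"
      using Cons.prems(1) weight_nonzero by (simp_all add: v_def)
    \<comment> \<open>The terms produced by one rewriting step are congruent to their reductions.\<close>
    have low: "(\<Sum>f\<in>A. pm_scale (?w f) (?s f - extend f (reduct p (bar f) x))) \<in> relation_ideal"
    proof (intro ideal_sum ideal_scale)
      fix f assume "f \<in> A"
      then have f: "f \<in> arcs Q" "tail Q f = v"
        by (auto simp: A_def)
      let ?d = "Poly_Mapping.single (head Q f, bar f # p, x) 1 - reduct p (bar f) x"
      have "?d \<in> relation_ideal"
        using Cons.IH[of "bar f"] f p by simp
      moreover have "fst P = head Q f" if "P \<in> Poly_Mapping.keys ?d" for P
        using subsetD[OF Poly_Mapping.keys_diff that] reduct_start[of P p "bar f" x] by auto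
      ultimately have "extend f ?d \<in> relation_ideal"
        by (intro extend_ideal f(1))
      then show "?s f - extend f (reduct p (bar f) x) \<in> relation_ideal"
        by (simp add: pm_linear_diff[OF pm_linear_extend] f(2))
    qed
    have "pm_scale (inverse (weight e)) (\<Sum>f\<in>out_arcs Q v. pm_scale (weight f) (?s f)) \<in> relation_ideal"
      by (intro ideal_scale vertex_relation_ideal p)
    also have "pm_scale (inverse (weight e)) (\<Sum>f\<in>out_arcs Q v. pm_scale (weight f) (?s f))
        = (\<Sum>f\<in>out_arcs Q v. pm_scale (?w f) (?s f))"
      by (simp add: pm.scale_sum_right divide_inverse mult.commute)
    also have "\<dots> = pm_scale (?w e) (?s e) + (\<Sum>f\<in>A. pm_scale (?w f) (?s f))"
      unfolding A_def by (rule sum.remove[OF finite_out_arcs e(1)])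
    also have "pm_scale (?w e) (?s e) = ?s e"
      using e(2) by simp
    finally have "?s e + (\<Sum>f\<in>A. pm_scale (?w f) (?s f))
        - (\<Sum>f\<in>A. pm_scale (?w f) (?s f - extend f (reduct p (bar f) x))) \<in> relation_ideal"
      using low by (rule ideal_diff)
    also have "?s e + (\<Sum>f\<in>A. pm_scale (?w f) (?s f))
        - (\<Sum>f\<in>A. pm_scale (?w f) (?s f - extend f (reduct p (bar f) x)))
      = ?s e - (- (\<Sum>f\<in>A. pm_scale (?w f) (extend f (reduct p (bar f) x))))"
      by (simp only: pm.scale_right_diff_distrib sum_subtractf) simp
    also have "\<dots> = Poly_Mapping.single (tail Q e, e # e' # p, x) 1 - reduct (e' # p) e x"
      using True by (simp add: A_def v_def)
    finally show ?thesis .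
  next
    case False
    then have "reduct (e' # p) e x = Poly_Mapping.single (tail Q e, e # e' # p, x) 1"
      by auto
    then show ?thesis
      by (simp add: ideal_zero)
  qed
qed (simp add: ideal_zero)

lemma act_congruent:
  assumes "e \<in> arcs Q" "Poly_Mapping.keys f \<subseteq> {(head Q e, p, x) | p x. awalk (head Q e) p x}"
  shows "extend e f - act e f \<in> relation_ideal"
proof -
  have "lin_ext (\<lambda>P. (case P of (u, p, x) \<Rightarrow> Poly_Mapping.single (tail Q e, e # p, x) 1)
      - (case P of (u, p, x) \<Rightarrow> reduct p e x)) f \<in> relation_ideal"
    using assms(2) by (intro ideal_lin_ext) (auto intro: reduct_congruent[OF assms(1)])
  then show ?thesis
    by (simp add: lin_ext_diff extend_def act_def)
qed

lemma path_congruent: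
  assumes "awalk u p x"
  shows "Poly_Mapping.single (u, p, x) 1 - acts p (Poly_Mapping.single (x, [], x) 1) \<in> relation_ideal"
  using assms
proof (induction p arbitrary: u)
  case Nil
  then show ?case
    by (auto simp: awalk_Nil_iff ideal_zero)
next
  case (Cons e p)
  let ?n = "acts p (Poly_Mapping.single (x, [], x) 1)"
  let ?d = "Poly_Mapping.single (head Q e, p, x) 1 - ?n"
  have e: "e \<in> arcs Q" "tail Q e = u" and p: "awalk (head Q e) p x"
    using Cons.prems by (auto simp: awalk_Cons_iff)
  have n: "Poly_Mapping.keys ?n \<subseteq> {(head Q e, p, x) | p x. awalk (head Q e) p x}"
    using leads_path[OF p] unfolding leads_def normal_paths_def by blast
  have "fst P = head Q e" if "P \<in> Poly_Mapping.keys ?d" for P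
    using subsetD[OF Poly_Mapping.keys_diff that] n by auto
  then have "extend e ?d \<in> relation_ideal"
    by (intro extend_ideal e(1) Cons.IH p)
  then have "extend e ?d + (extend e ?n - act e ?n) \<in> relation_ideal"
    by (rule ideal_add[OF _ act_congruent[OF e(1) n]])
  then show ?case
    by (simp add: pm_linear_diff[OF pm_linear_extend] e(2))
qed

lemma normal_form_congruent:
  assumes "f \<in> carrier \<A>"
  shows "f - normal_form f \<in> relation_ideal"
proof -
  have "lin_ext (\<lambda>P. Poly_Mapping.single P 1
      - (case P of (u, p, x) \<Rightarrow> acts p (Poly_Mapping.single (x, [], x) 1))) f \<in> relation_ideal"
    using assms path_congruent by (intro ideal_lin_ext) (fastforce simp: path_algebra_simps qpaths_def)
  then show ?thesis
    by (simp add: lin_ext_diff lin_ext_singles normal_form_def)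
qed

lemma ideal_iff_normal_form:
  assumes "f \<in> carrier \<A>"
  shows "f \<in> relation_ideal \<longleftrightarrow> normal_form f = 0"
  using normal_form_ideal normal_form_congruent[OF assms] by fastforce

definition between :: "'a \<Rightarrow> 'a \<Rightarrow> ('a, 'b) qpath set" where
  "between u v = {(u, p, v) | p. awalk u p v}"

lemma keys_normal_form:
  assumes "Poly_Mapping.keys f \<subseteq> between u v"
  shows "Poly_Mapping.keys (normal_form f) \<subseteq> normal_paths u v"
proof -
  have "Poly_Mapping.keys (normal_form f) \<subseteq> (\<Union>P\<in>Poly_Mapping.keys f.
      Poly_Mapping.keys ((\<lambda>(u, p, x). acts p (Poly_Mapping.single (x, [], x) 1)) P))"
    unfolding normal_form_def by (rule keys_lin_ext)
  also have "\<dots> \<subseteq> normal_paths u v"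
    using assms leads_path by (force simp: between_def leads_def)
  finally show ?thesis .
qed

lemma between_carrier: "Poly_Mapping.keys f \<subseteq> between u v \<Longrightarrow> f \<in> carrier \<A>"
  by (auto simp: between_def path_algebra_simps qpaths_def)

text \<open>
  The absence of zero divisors, formulated for representatives in the path algebra: both factors may be
  replaced by their normal forms.
\<close>

theorem mult_in_ideal:
  assumes f: "Poly_Mapping.keys f \<subseteq> between u v" and g: "Poly_Mapping.keys g \<subseteq> between v x"
    and fg: "path_mult f g \<in> relation_ideal"
  shows "f \<in> relation_ideal \<or> g \<in> relation_ideal"
proof (rule ccontr)
  assume neither: "\<not> (f \<in> relation_ideal \<or> g \<in> relation_ideal)"
  let ?f = "normal_form f" and ?g = "normal_form g"
  have fc: "f \<in> carrier \<A>" and gc: "g \<in> carrier \<A>"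
    using between_carrier f g by blast+
  have nf: "Poly_Mapping.keys ?f \<subseteq> normal_paths u v" "Poly_Mapping.keys ?g \<subseteq> normal_paths v x"
    using keys_normal_form f g by blast+
  then have c: "?f \<in> carrier \<A>" "?g \<in> carrier \<A>"
    unfolding path_algebra_simps using normal_paths_qpaths by blast+
  have nonzero: "?f \<noteq> 0" "?g \<noteq> 0"
    using neither ideal_iff_normal_form fc gc by blast+
  have "path_mult (f - ?f) g \<in> relation_ideal" "path_mult ?f (g - ?g) \<in> relation_ideal"
    using ideal_mult_right ideal_mult_left normal_form_congruent fc gc c by blast+
  then have "path_mult f g - (path_mult (f - ?f) g + path_mult ?f (g - ?g)) \<in> relation_ideal"
    using fg ideal_add ideal_diff by blast
  then have "path_mult ?f ?g \<in> relation_ideal"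
    by (simp add: pm_linear_diff[OF pm_linear_path_mult_left] pm_linear_diff[OF pm_linear_path_mult_right])
  then show False
    using normal_form_ideal normal_form_mult_nonzero[OF nf(1) nonzero(1) nf(2) nonzero(2)] by blast
qed

lemma path_not_in_ideal:
  assumes "awalk u p v"
  shows "Poly_Mapping.single (u, p, v) 1 \<notin> relation_ideal"
proof
  assume "Poly_Mapping.single (u, p, v) 1 \<in> relation_ideal"
  then have "acts p (Poly_Mapping.single (v, [], v) 1) = 0"
    using normal_form_ideal[of "Poly_Mapping.single (u, p, v) 1"] by (simp add: normal_form_single)
  then show False
    using leads_path[OF assms] by (simp add: leads_def)
qed

end

section \<open>The quotient algebra\<close>

context weighted_quiver
begin

interpretation A: ring \<A>
  by (rule ring_path_algebra)

interpretation I: ideal relation_ideal \<A>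
  by (rule ideal_relation_ideal)

abbreviation \<P> :: "(('a, 'b) qpath \<Rightarrow>\<^sub>0 'k) set ring" where
  "\<P> \<equiv> \<A> Quot relation_ideal"

interpretation P: ring \<P>
  by (rule I.quotient_is_ring)

abbreviation cls :: "(('a, 'b) qpath \<Rightarrow>\<^sub>0 'k) \<Rightarrow> (('a, 'b) qpath \<Rightarrow>\<^sub>0 'k) set" where
  "cls f \<equiv> relation_ideal +>\<^bsub>\<A>\<^esub> f"

lemma cls_closed: "f \<in> carrier \<A> \<Longrightarrow> cls f \<in> carrier \<P>"
  and cls_mult: "f \<in> carrier \<A> \<Longrightarrow> g \<in> carrier \<A> \<Longrightarrow> cls f \<otimes>\<^bsub>\<P>\<^esub> cls g = cls (path_mult f g)"
  and cls_add: "f \<in> carrier \<A> \<Longrightarrow> g \<in> carrier \<A> \<Longrightarrow> cls f \<oplus>\<^bsub>\<P>\<^esub> cls g = cls (f + g)"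
  and cls_one: "\<one>\<^bsub>\<P>\<^esub> = cls (\<Sum>v\<in>verts Q. trivial_path v)"
  using ring_hom_memE[OF I.rcos_ring_hom] by (simp_all add: mult_path_algebra path_algebra_simps)

lemma cls_zero_iff: "f \<in> carrier \<A> \<Longrightarrow> cls f = \<zero>\<^bsub>\<P>\<^esub> \<longleftrightarrow> f \<in> relation_ideal"
  using I.rcos_const_imp_mem A.a_rcos_zero[OF ideal_relation_ideal] by (auto simp: FactRing_def)

lemma cls_surj: "x \<in> carrier \<P> \<Longrightarrow> \<exists>f\<in>carrier \<A>. x = cls f"
  by (auto simp: FactRing_def A_RCOSETS_def')

lemma path_mult_carrier: "f \<in> carrier \<A> \<Longrightarrow> g \<in> carrier \<A> \<Longrightarrow> path_mult f g \<in> carrier \<A>"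
  using A.m_closed[of f g] by (simp add: mult_path_algebra)

lemma cls_sum:
  assumes "finite S" "S \<subseteq> verts Q"
  shows "(\<Oplus>\<^bsub>\<P>\<^esub>v\<in>S. cls (trivial_path v)) = cls (\<Sum>v\<in>S. trivial_path v)
    \<and> (\<Sum>v\<in>S. trivial_path v) \<in> carrier \<A>"
  using assms
proof (induction S rule: finite_induct)
  case empty
  then show ?case
    using cls_zero_iff[of 0] ideal_zero by (simp add: path_algebra_simps)
next
  case (insert v S)
  let ?s = "\<Sum>v\<in>S. trivial_path v"
  have s: "(\<Oplus>\<^bsub>\<P>\<^esub>v\<in>S. cls (trivial_path v)) = cls ?s" "?s \<in> carrier \<A>"
    using insert by auto
  have "(\<Oplus>\<^bsub>\<P>\<^esub>v\<in>insert v S. cls (trivial_path v)) = cls (trivial_path v) \<oplus>\<^bsub>\<P>\<^esub> cls ?s"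
    using insert.hyps insert.prems s(1) cls_closed trivial_path_carrier
    by (subst P.finsum_insert) (auto simp: Pi_def subset_iff)
  also have "\<dots> = cls (trivial_path v + ?s)"
    using insert.prems s(2) trivial_path_carrier by (simp add: cls_add)
  finally show ?case
    using insert.hyps insert.prems A.a_closed[OF trivial_path_carrier s(2), of v]
    by (simp add: path_algebra_simps(4))
qed

definition corner :: "'a \<Rightarrow> (('a, 'b) qpath \<Rightarrow>\<^sub>0 'k) \<Rightarrow> 'a \<Rightarrow> (('a, 'b) qpath \<Rightarrow>\<^sub>0 'k)" where
  "corner u f v = path_mult (path_mult (trivial_path u) f) (trivial_path v)"

lemma keys_corner:
  assumes "f \<in> carrier \<A>"
  shows "Poly_Mapping.keys (corner u f v) \<subseteq> between u v"
proof
  fix P assume P: "P \<in> Poly_Mapping.keys (corner u f v)"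
  let ?t = "\<lambda>v. trivial_path v :: ('a, 'b) qpath \<Rightarrow>\<^sub>0 'k"
  obtain w p y q x where 1: "P = (w, p @ q, x)" "(w, p, y) \<in> Poly_Mapping.keys (path_mult (?t u) f)"
      "(y, q, x) \<in> Poly_Mapping.keys (?t v)"
    using subsetD[OF keys_path_mult P[unfolded corner_def]] by blast
  obtain w' p' y' q' x' where 2: "(w, p, y) = (w', p' @ q', x')" "(w', p', y') \<in> Poly_Mapping.keys (?t u)"
      "(y', q', x') \<in> Poly_Mapping.keys f"
    using subsetD[OF keys_path_mult 1(2)] by blast
  have "(u, p, v) \<in> Poly_Mapping.keys f" "P = (u, p, v)"
    using 1(1,3) 2 by (auto simp: trivial_path_def)
  then show "P \<in> between u v"
    using assms by (auto simp: between_def path_algebra_simps qpaths_def)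
qed

text \<open>
  An element is the sum of its corners.
\<close>

lemma ex_corner_not_in_ideal:
  assumes f: "f \<in> carrier \<A>" "f \<notin> relation_ideal"
  shows "\<exists>u\<in>verts Q. \<exists>v\<in>verts Q. corner u f v \<notin> relation_ideal"
proof (rule ccontr)
  assume "\<not> (\<exists>u\<in>verts Q. \<exists>v\<in>verts Q. corner u f v \<notin> relation_ideal)"
  then have "(\<Sum>u\<in>verts Q. \<Sum>v\<in>verts Q. corner u f v) \<in> relation_ideal"
    by (intro ideal_sum) blast
  also have "(\<Sum>u\<in>verts Q. \<Sum>v\<in>verts Q. corner u f v)
      = (\<Sum>u\<in>verts Q. path_mult (path_mult (trivial_path u) f) (\<Sum>v\<in>verts Q. trivial_path v))"
    unfolding corner_def by (simp only: pm_linear_sum[OF pm_linear_path_mult_right])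
  also have "\<dots> = path_mult (path_mult (\<Sum>u\<in>verts Q. trivial_path u) f) (\<Sum>v\<in>verts Q. trivial_path v)"
    by (simp only: pm_linear_sum[OF pm_linear_path_mult_left])
  also have "\<dots> = f"
    using f(1) by (simp add: path_mult_one_left path_mult_one_right path_algebra_simps)
  finally show False
    using f(2) by blast
qed

lemma peirce_cls:
  assumes "x \<in> peirce \<P> (cls (trivial_path u)) (cls (trivial_path v))" "u \<in> verts Q" "v \<in> verts Q"
  shows "\<exists>f. x = cls f \<and> Poly_Mapping.keys f \<subseteq> between u v"
proof -
  obtain r where r: "r \<in> carrier \<P>" "x = cls (trivial_path u) \<otimes>\<^bsub>\<P>\<^esub> r \<otimes>\<^bsub>\<P>\<^esub> cls (trivial_path v)"
    using assms(1) unfolding peirce_def by blast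
  then obtain f where f: "f \<in> carrier \<A>" "r = cls f"
    using cls_surj by blast
  then have "x = cls (corner u f v)"
    using r assms(2,3) by (simp add: cls_mult trivial_path_carrier path_mult_carrier corner_def)
  then show ?thesis
    using keys_corner[OF f(1)] by blast
qed

theorem piecewise_domain_quotient: "piecewise_domain \<P> (verts Q) (\<lambda>v. cls (trivial_path v))"
proof (intro piecewise_domain.intro piecewise_domain_axioms.intro)
  show "ring \<P>"
    by (rule P.ring_axioms)
  show "finite (verts Q)"
    by simp
  show "cls (trivial_path v) \<in> carrier \<P>" if "v \<in> verts Q" for v
    using that by (simp add: cls_closed trivial_path_carrier)
  show "cls (trivial_path v) \<otimes>\<^bsub>\<P>\<^esub> cls (trivial_path v) = cls (trivial_path v)" if "v \<in> verts Q" for v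
    using that by (simp add: cls_mult trivial_path_carrier) (simp add: trivial_path_def)
  show "cls (trivial_path u) \<otimes>\<^bsub>\<P>\<^esub> cls (trivial_path v) = \<zero>\<^bsub>\<P>\<^esub>"
    if "u \<in> verts Q" "v \<in> verts Q" "u \<noteq> v" for u v
  proof -
    have "path_mult (trivial_path u) (trivial_path v :: ('a, 'b) qpath \<Rightarrow>\<^sub>0 'k) = 0"
      using that(3) by (simp add: trivial_path_def)
    then have "cls (trivial_path u) \<otimes>\<^bsub>\<P>\<^esub> cls (trivial_path v) = cls 0"
      using cls_mult[OF trivial_path_carrier[OF that(1)] trivial_path_carrier[OF that(2)]] by simp
    also have "cls 0 = \<zero>\<^bsub>\<P>\<^esub>"
      using cls_zero_iff[of 0] ideal_zero by (simp add: path_algebra_simps(1))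
    finally show ?thesis .
  qed
  show "\<one>\<^bsub>\<P>\<^esub> = (\<Oplus>\<^bsub>\<P>\<^esub>v\<in>verts Q. cls (trivial_path v))"
    using cls_sum[of "verts Q"] by (simp add: cls_one)
  fix u v w x y
  assume verts: "u \<in> verts Q" "v \<in> verts Q" "w \<in> verts Q"
    and x: "x \<in> peirce \<P> (cls (trivial_path u)) (cls (trivial_path v))"
    and y: "y \<in> peirce \<P> (cls (trivial_path v)) (cls (trivial_path w))"
    and xy: "x \<otimes>\<^bsub>\<P>\<^esub> y = \<zero>\<^bsub>\<P>\<^esub>"
  obtain f g where f: "x = cls f" "Poly_Mapping.keys f \<subseteq> between u v"
    and g: "y = cls g" "Poly_Mapping.keys g \<subseteq> between v w"
    using peirce_cls x y verts by meson
  have c: "f \<in> carrier \<A>" "g \<in> carrier \<A>"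
    using between_carrier f(2) g(2) by blast+
  then have "path_mult f g \<in> relation_ideal"
    using xy f(1) g(1) by (simp add: cls_mult cls_zero_iff path_mult_carrier)
  then show "x = \<zero>\<^bsub>\<P>\<^esub> \<or> y = \<zero>\<^bsub>\<P>\<^esub>"
    using mult_in_ideal[OF f(2) g(2)] c f(1) g(1) by (simp add: cls_zero_iff)
qed

text \<open>
  Nonzero corners \<open>f\<close> and \<open>g\<close> from the two ideals can be joined by a path \<open>h\<close>. As \<open>h\<close> is nonzero in the
  quotient, so is \<open>f h g\<close>, which lies in the product of the ideals.
\<close>

theorem prime_ring_quotient:
  assumes nonempty: "verts Q \<noteq> {}"
    and connected: "\<And>u v. u \<in> verts Q \<Longrightarrow> v \<in> verts Q \<Longrightarrow> u \<rightarrow>\<^sup>*\<^bsub>Q\<^esub> v"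
  shows "prime_ring \<P>"
proof (intro prime_ring.intro prime_ring_axioms.intro)
  show "ring \<P>"
    by (rule P.ring_axioms)
  show "\<one>\<^bsub>\<P>\<^esub> \<noteq> \<zero>\<^bsub>\<P>\<^esub>"
  proof
    assume one: "\<one>\<^bsub>\<P>\<^esub> = \<zero>\<^bsub>\<P>\<^esub>"
    obtain v where v: "v \<in> verts Q"
      using nonempty by blast
    have "cls (trivial_path v) = \<zero>\<^bsub>\<P>\<^esub>"
      using P.one_zeroD[OF one] cls_closed[OF trivial_path_carrier[OF v]] by simp
    then have "trivial_path v \<in> relation_ideal"
      using cls_zero_iff[OF trivial_path_carrier[OF v]] by blast
    then show False
      using path_not_in_ideal[of v "[]" v] v by (simp add: trivial_path_def awalk_Nil_iff)
  qed
  have nonzero_corner: "\<exists>u v f. u \<in> verts Q \<and> v \<in> verts Q \<and> Poly_Mapping.keys f \<subseteq> between u v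
      \<and> f \<notin> relation_ideal \<and> cls f \<in> J"
    if J: "ideal J \<P>" "J \<noteq> {\<zero>\<^bsub>\<P>\<^esub>}" for J
  proof -
    have "\<zero>\<^bsub>\<P>\<^esub> \<in> J" "J \<subseteq> carrier \<P>"
      using J(1) by (simp_all add: ideal.axioms(1) additive_subgroup.zero_closed additive_subgroup.a_subset)
    then obtain x where x: "x \<in> J" "x \<noteq> \<zero>\<^bsub>\<P>\<^esub>" "x \<in> carrier \<P>"
      using J(2) by blast
    then obtain f where f: "f \<in> carrier \<A>" "x = cls f"
      using cls_surj by blast
    then have "f \<notin> relation_ideal"
      using x(2) cls_zero_iff by blast
    then obtain u v where uv: "u \<in> verts Q" "v \<in> verts Q" "corner u f v \<notin> relation_ideal"
      using ex_corner_not_in_ideal f(1) by blast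
    have "cls (trivial_path u) \<otimes>\<^bsub>\<P>\<^esub> x \<otimes>\<^bsub>\<P>\<^esub> cls (trivial_path v) \<in> J"
      using J(1) x(1) uv cls_closed trivial_path_carrier
      by (intro ideal.I_r_closed[OF J(1)] ideal.I_l_closed[OF J(1)]) auto
    then have "cls (corner u f v) \<in> J"
      using f uv by (simp add: cls_mult trivial_path_carrier path_mult_carrier corner_def)
    then show ?thesis
      using uv keys_corner[OF f(1)] by blast
  qed
  fix J K assume J: "ideal J \<P>" and K: "ideal K \<P>" and JK: "J \<cdot>\<^bsub>\<P>\<^esub> K = {\<zero>\<^bsub>\<P>\<^esub>}"
  show "J = {\<zero>\<^bsub>\<P>\<^esub>} \<or> K = {\<zero>\<^bsub>\<P>\<^esub>}"
  proof (rule ccontr)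
    assume "\<not> (J = {\<zero>\<^bsub>\<P>\<^esub>} \<or> K = {\<zero>\<^bsub>\<P>\<^esub>})"
    then obtain u v f w x g where f: "v \<in> verts Q" "Poly_Mapping.keys f \<subseteq> between u v"
        "f \<notin> relation_ideal" "cls f \<in> J"
      and g: "w \<in> verts Q" "Poly_Mapping.keys g \<subseteq> between w x" "g \<notin> relation_ideal" "cls g \<in> K"
      using nonzero_corner[OF J] nonzero_corner[OF K] by blast
    obtain p where p: "awalk v p w"
      using connected[OF f(1) g(1)] reachable_awalk by blast
    define h where "h = (Poly_Mapping.single (v, p, w) 1 :: ('a, 'b) qpath \<Rightarrow>\<^sub>0 'k)"
    have h: "Poly_Mapping.keys h \<subseteq> between v w" "h \<notin> relation_ideal"
      using p path_not_in_ideal by (simp_all add: h_def between_def)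
    have c: "f \<in> carrier \<A>" "g \<in> carrier \<A>" "h \<in> carrier \<A>"
      using between_carrier f(2) g(2) h(1) by blast+
    have keys_fh: "Poly_Mapping.keys (path_mult f h) \<subseteq> between u w"
    proof
      fix P assume "P \<in> Poly_Mapping.keys (path_mult f h)"
      then obtain u' p' y q x' where "P = (u', p' @ q, x')"
          "(u', p', y) \<in> Poly_Mapping.keys f" "(y, q, x') \<in> Poly_Mapping.keys h"
        using subsetD[OF keys_path_mult] by blast
      moreover from this have "(u', p', y) \<in> between u v" "(y, q, x') \<in> between v w"
        using f(2) h(1) by blast+
      ultimately show "P \<in> between u w"
        by (auto simp: between_def)
    qed
    have "path_mult f h \<notin> relation_ideal"
      using mult_in_ideal[OF f(2) h(1)] f(3) h(2) by blast
    then have "path_mult (path_mult f h) g \<notin> relation_ideal"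
      using mult_in_ideal[OF keys_fh g(2)] g(3) by blast
    moreover have "cls f \<otimes>\<^bsub>\<P>\<^esub> cls h \<in> J"
      by (rule ideal.I_r_closed[OF J f(4) cls_closed[OF c(3)]])
    then have "cls f \<otimes>\<^bsub>\<P>\<^esub> cls h \<otimes>\<^bsub>\<P>\<^esub> cls g \<in> J \<cdot>\<^bsub>\<P>\<^esub> K"
      using g(4) by (rule ideal_prod.prod)
    then have "cls (path_mult (path_mult f h) g) = \<zero>\<^bsub>\<P>\<^esub>"
      using JK c by (simp add: cls_mult path_mult_carrier)
    ultimately show False
      using c by (simp add: cls_zero_iff path_mult_carrier)
  qed
qed

end

section \<open>The double quiver\<close>

definition double_bar :: "'a + 'a \<Rightarrow> 'a + 'a" where
  "double_bar = case_sum Inr Inl"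

lemma bar_quiver_double:
  assumes "fin_digraph \<Gamma>"
  shows "bar_quiver (double_quiver \<Gamma>) double_bar"
proof -
  interpret fin_digraph \<Gamma>
    by (rule assms)
  show ?thesis
    by unfold_locales (auto simp: double_quiver_def double_bar_def split: sum.splits)
qed

text \<open>
  The arrows of the double quiver that leave \<open>v\<close> are the arrows of \<open>\<Gamma>\<close> that leave \<open>v\<close> and the reverses
  of those that enter \<open>v\<close>; their number is the degree, also when there are loops.
\<close>

lemma double_other_arc:
  assumes "fin_digraph \<Gamma>" "quiver_degree \<Gamma> v \<ge> 2"
  shows "\<exists>e'\<in>arcs (double_quiver \<Gamma>). tail (double_quiver \<Gamma>) e' = v \<and> e' \<noteq> e"
proof (rule ccontr)
  interpret fin_digraph \<Gamma>
    by (rule assms(1))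
  let ?S = "Inl ` out_arcs \<Gamma> v \<union> Inr ` in_arcs \<Gamma> v"
  assume "\<not> ?thesis"
  then have "?S \<subseteq> {e}"
    by (auto simp: double_quiver_def)
  then have "card ?S \<le> 1"
    using card_mono[of "{e}" ?S] by simp
  moreover have "card ?S = quiver_degree \<Gamma> v"
    unfolding quiver_degree_def in_degree_def out_degree_def
    using finite_in_arcs finite_out_arcs by (subst card_Un_disjoint) (auto simp: card_image)
  ultimately show False
    using assms(2) by simp
qed

lemma double_reachable:
  assumes "wf_digraph \<Gamma>" "connected \<Gamma>" "u \<in> verts \<Gamma>" "v \<in> verts \<Gamma>"
  shows "u \<rightarrow>\<^sup>*\<^bsub>double_quiver \<Gamma>\<^esub> v"
proof -
  have "arcs_ends (with_proj (mk_symmetric \<Gamma>)) = arcs_ends (double_quiver \<Gamma>)"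
    by (force simp: arcs_ends_conv parcs_mk_symmetric double_quiver_def)
  then show ?thesis
    using assms(2-4) by (simp add: connected_def strongly_connected_def reachable_def double_quiver_def)
qed

lemma preprojective_relation_eq:
  fixes \<Gamma> :: "('v, 'a) pre_digraph"
  assumes "finite (arcs \<Gamma>)"
  shows "preprojective_relation TYPE('k::field) \<Gamma> =
    (\<Sum>e\<in>arcs (double_quiver \<Gamma>). pm_scale (case_sum (\<lambda>_. 1) (\<lambda>_. - 1) e)
      (Poly_Mapping.single (tail (double_quiver \<Gamma>) e, [e, double_bar e], tail (double_quiver \<Gamma>) e) 1))"
    (is "_ = sum ?t _")
proof -
  let ?Q = "double_quiver \<Gamma>"
  have "sum ?t (arcs ?Q) = sum ?t (Inl ` arcs \<Gamma>) + sum ?t (Inr ` arcs \<Gamma>)"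
    unfolding double_quiver_def using assms by (simp, subst sum.union_disjoint) auto
  also have "\<dots> = (\<Sum>\<alpha>\<in>arcs \<Gamma>. ?t (Inl \<alpha>)) + (\<Sum>\<alpha>\<in>arcs \<Gamma>. ?t (Inr \<alpha>))"
    by (simp add: sum.reindex)
  also have "\<dots> = (\<Sum>\<alpha>\<in>arcs \<Gamma>. ?t (Inl \<alpha>) + ?t (Inr \<alpha>))"
    by (rule sum.distrib[symmetric])
  also have "\<dots> = preprojective_relation TYPE('k) \<Gamma>"
    unfolding preprojective_relation_def Let_def mult_path_algebra
    by (intro sum.cong) (simp_all add: arrow_def double_bar_def double_quiver_def single_uminus)
  finally show ?thesis ..
qed

theorem corollary5p5:
  fixes \<Gamma> :: "('v, 'a) pre_digraph"
  assumes "fin_digraph \<Gamma>"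
    and "verts \<Gamma> \<noteq> {}"
    and "\<forall>v\<in>verts \<Gamma>. quiver_degree \<Gamma> v \<ge> 2"
  shows "piecewise_domain (preprojective_algebra TYPE('k::field) \<Gamma>)
           (verts \<Gamma>) (vertex_idem TYPE('k) \<Gamma>)
       \<and> (connected \<Gamma> \<longrightarrow>
            prime_ring (preprojective_algebra TYPE('k) \<Gamma>)
          \<and> piecewise_domain (preprojective_algebra TYPE('k) \<Gamma>)
              (verts \<Gamma>) (vertex_idem TYPE('k) \<Gamma>))"
proof -
  let ?Q = "double_quiver \<Gamma>"
  let ?w = "case_sum (\<lambda>_. 1) (\<lambda>_. - 1) :: 'a + 'a \<Rightarrow> 'k"
  interpret \<Gamma>: fin_digraph \<Gamma>
    by (rule assms(1))
  interpret Q: bar_quiver ?Q double_bar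
    by (rule bar_quiver_double[OF assms(1)])
  have verts: "verts ?Q = verts \<Gamma>"
    by (simp add: double_quiver_def)
  have other: "\<exists>e'\<in>arcs ?Q. tail ?Q e' = v \<and> e' \<noteq> e" if "v \<in> verts ?Q" for v e
    using that assms(3) by (intro double_other_arc[OF assms(1)]) (simp add: verts)
  obtain c where c: "Q.orients (verts ?Q) c"
    using Q.ex_orients[OF other] by blast
  obtain r :: "'a + 'a \<Rightarrow> nat" where r: "inj_on r (arcs ?Q)"
    using finite_imp_inj_to_nat_seg[OF Q.finite_arcs] by blast
  interpret Q: weighted_quiver ?Q double_bar c "\<lambda>e. Suc (r e)" ?w
  proof unfold_locales
    show "inj_on (\<lambda>e. Suc (r e)) (arcs ?Q)"
      using r by (simp add: inj_on_def)
  qed (use c other in \<open>auto split: sum.split\<close>)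
  have "preprojective_relation TYPE('k) \<Gamma> = Q.relation"
    unfolding Q.relation_def by (rule preprojective_relation_eq) simp
  then have "preprojective_ideal TYPE('k) \<Gamma> = Q.relation_ideal"
    unfolding preprojective_ideal_def Q.relation_ideal_def by (rule arg_cong)
  then have algebra: "preprojective_algebra TYPE('k) \<Gamma> = path_algebra TYPE('k) ?Q Quot Q.relation_ideal"
    and idem: "vertex_idem TYPE('k) \<Gamma> = (\<lambda>v. Q.relation_ideal +>\<^bsub>path_algebra TYPE('k) ?Q\<^esub> trivial_path v)"
    by (simp_all add: preprojective_algebra_def vertex_idem_def fun_eq_iff)
  have "piecewise_domain (preprojective_algebra TYPE('k) \<Gamma>) (verts \<Gamma>) (vertex_idem TYPE('k) \<Gamma>)"
    using Q.piecewise_domain_quotient unfolding algebra idem verts .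
  moreover have "prime_ring (preprojective_algebra TYPE('k) \<Gamma>)" if "connected \<Gamma>"
    unfolding algebra
    by (rule Q.prime_ring_quotient)
      (use assms(2) verts double_reachable[OF \<Gamma>.wf_digraph that] in auto)
  ultimately show ?thesis
    by blast
qed

end
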